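(* Let $d,a,b,p$ satisfy the admissibility conditions below and $q=p/(p-1)$. Let $u\in\mathcal D^{1,2}_a(\mathbb R^d)$ be nonnegative and not identically zero, set $\kappa=\big(\int_{\mathbb R^d}|u|^p|x|^{-bp}dx\big)^{1/p}$, and let $v$ be defined by $|x|^{-2a}v=\kappa^{2-p}|x|^{-bp}u^{p-1}$; assume $v\in L^q(\mathbb R^d,|x|^{-(2a-b)q}dx)\cap\mathsf L_a(\mathcal D^{1,2}_a(\mathbb R^d))$. Then \[ 0\le\Big(\int_{\mathbb R^d}\frac{|v|^q}{|x|^{(2a-b)q}}dx\Big)^{2/q}-\frac1{\mathsf C_{a,b}}\langle v,\mathsf L_a^{-1}v\rangle\le\mathsf C_{a,b}\int_{\mathbb R^d}\frac{|\nabla u|^2}{|x|^{2a}}dx-\Big(\int_{\mathbb R^d}\frac{|u|^p}{|x|^{bp}}dx\Big)^{2/p}. \]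
   Context: Let $a_c=\frac{d-2}2$, $2^*=\infty$ if $d=1,2$ and $2^*=\frac{2d}{d-2}$ if $d\ge3$. Admissibility: $d\ge1$; $p\in[2,2^*]$ if $d\ge3$, $p\in[2,2^* )$ if $d=1,2$; $b=a-a_c+d/p$; $a<a_c$; and $a\le b\le a+1$ if $d\ge3$, $a<b\le a+1$ if $d=2$, $a+\frac12<b\le a+1$ if $d=1$. $\mathcal D^{1,2}_a(\mathbb R^d)$ is the completion of $C_c^\infty(\mathbb R^d\setminus\{0\})$ w.r.t. $u\mapsto\||x|^{-a}\nabla u\|_2$. $\mathsf C_{a,b}$ is the optimal (finite) constant with $\big(\int\frac{|u|^p}{|x|^{bp}}\big)^{2/p}\le\mathsf C_{a,b}\int\frac{|\nabla u|^2}{|x|^{2a}}$ for all $u\in\mathcal D^{1,2}_a(\mathbb R^d)$. $\langle u,v\rangle=\int u\,v\,|x|^{-2a}dx$; $\mathsf L_a u=-\Delta u+2a\frac{x}{|x|^2}\cdot\nabla u$, with inverse $\mathsf L_a^{-1}$ on $\mathsf L_a(\mathcal D^{1,2}_a(\mathbb R^d))$. *)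

theory Defs
  imports "HOL-Analysis.Analysis"
begin

fun pderiv_list :: "'a::euclidean_space list \<Rightarrow> ('a \<Rightarrow> real) \<Rightarrow> 'a \<Rightarrow> real" where
  "pderiv_list [] f = f"
| "pderiv_list (e # es) f = (\<lambda>x. deriv (\<lambda>t. pderiv_list es f (x + t *\<^sub>R e)) 0)"

definition smooth_on :: "'a::euclidean_space set \<Rightarrow> ('a \<Rightarrow> real) \<Rightarrow> bool" where
  "smooth_on S f \<longleftrightarrow>
     (\<forall>es. set es \<subseteq> Basis \<longrightarrow>
        continuous_on S (pderiv_list es f) \<and>
        (\<forall>e\<in>Basis. \<forall>x\<in>S.
           ((\<lambda>t. pderiv_list es f (x + t *\<^sub>R e)) has_real_derivative pderiv_list (e # es) f x) (at 0)))"

definition grad :: "('a::euclidean_space \<Rightarrow> real) \<Rightarrow> 'a \<Rightarrow> 'a" where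
  "grad f x = (\<Sum>e\<in>Basis. pderiv_list [e] f x *\<^sub>R e)"

definition test_fun :: "('a::euclidean_space \<Rightarrow> real) \<Rightarrow> bool" where
  "test_fun \<phi> \<longleftrightarrow> smooth_on (UNIV - {0}) \<phi> \<and>
     compact (closure {x. \<phi> x \<noteq> 0}) \<and> 0 \<notin> closure {x. \<phi> x \<noteq> 0}"

text \<open>(u, g) represents an element of D^{1,2}_a with (weak) gradient g: u and g arise as
  limit of test functions phi_k, with grad phi_k -> g in L^2(|x|^{-2a} dx) and phi_k -> u a.e.\<close>
definition D12 :: "real \<Rightarrow> ('a::euclidean_space \<Rightarrow> real) \<Rightarrow> ('a \<Rightarrow> 'a) \<Rightarrow> bool" where
  "D12 a u g \<longleftrightarrow> u \<in> borel_measurable lborel \<and> g \<in> borel_measurable lborel \<and>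
     (\<exists>\<phi> :: nat \<Rightarrow> 'a \<Rightarrow> real. (\<forall>k. test_fun (\<phi> k)) \<and>
        ((\<lambda>k. \<integral>\<^sup>+ x. ennreal ((norm (grad (\<phi> k) x - g x))\<^sup>2 * norm x powr (-2*a)) \<partial>lborel)
            \<longlonglongrightarrow> 0) \<and>
        (AE x in lborel. (\<lambda>k. \<phi> k x) \<longlonglongrightarrow> u x))"

definition energy :: "real \<Rightarrow> ('a::euclidean_space \<Rightarrow> 'a) \<Rightarrow> real" where
  "energy a g = (\<integral>x. (norm (g x))\<^sup>2 * norm x powr (-2*a) \<partial>lborel)"

definition wLp :: "real \<Rightarrow> real \<Rightarrow> ('a::euclidean_space \<Rightarrow> real) \<Rightarrow> real" where
  "wLp b p u = (\<integral>x. \<bar>u x\<bar> powr p * norm x powr (-b*p) \<partial>lborel)"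

text \<open>Optimal CKN constant C_{a,b} (p is determined by a, b, d).\<close>
definition CKN_const :: "'a::euclidean_space itself \<Rightarrow> real \<Rightarrow> real \<Rightarrow> real \<Rightarrow> real" where
  "CKN_const _ a b p = Inf {C. \<forall>(u::'a \<Rightarrow> real) g. D12 a u g \<longrightarrow> wLp b p u powr (2/p) \<le> C * energy a g}"

text \<open>v = L_a w in the weak sense: -div(|x|^{-2a} grad w) = |x|^{-2a} v tested against C_c^infinity(R^d minus 0).\<close>
definition La_weak :: "real \<Rightarrow> ('a::euclidean_space \<Rightarrow> real) \<Rightarrow> ('a \<Rightarrow> 'a) \<Rightarrow> ('a \<Rightarrow> real) \<Rightarrow> bool" where
  "La_weak a w gw v \<longleftrightarrow> (\<forall>\<phi>. test_fun \<phi> \<longrightarrow>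
     (\<integral>x. v x * \<phi> x * norm x powr (-2*a) \<partial>lborel) =
     (\<integral>x. (gw x \<bullet> grad \<phi> x) * norm x powr (-2*a) \<partial>lborel))"

definition admissible :: "nat \<Rightarrow> real \<Rightarrow> real \<Rightarrow> real \<Rightarrow> bool" where
  "admissible d a b p \<longleftrightarrow> d \<ge> 1 \<and>
     (let ac = (real d - 2) / 2 in
       p \<ge> 2 \<and> (d \<ge> 3 \<longrightarrow> p \<le> 2 * real d / (real d - 2)) \<and>
       b = a - ac + real d / p \<and> a < ac \<and>
       (d \<ge> 3 \<longrightarrow> a \<le> b \<and> b \<le> a + 1) \<and>
       (d = 2 \<longrightarrow> a < b \<and> b \<le> a + 1) \<and>
       (d = 1 \<longrightarrow> a + 1/2 < b \<and> b \<le> a + 1))"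

end

theory Submission
  imports Defs
begin

text \<open>
  Write \<open>M\<close> for the squared weighted norm of \<open>u\<close>. The choice of \<open>v\<close> makes its squared dual norm and
  \<open>\<langle>v, u\<rangle>\<close> both equal to \<open>M\<close>, and testing the equation for \<open>w\<close> gives \<open>\<langle>v, w\<rangle> = \<parallel>\<nabla>w\<parallel>\<^sup>2\<close> and
  \<open>M = \<langle>\<nabla>w, \<nabla>u\<rangle>\<close> in the weighted \<open>L\<^sup>2\<close> space. The lower bound is duality together with the inequality
  for \<open>w\<close>; the upper bound is \<open>2M \<le> C \<parallel>\<nabla>u\<parallel>\<^sup>2 + \<parallel>\<nabla>w\<parallel>\<^sup>2 / C\<close>.

  The constant is an infimum of reals, so this argument needs a finite admissible constant, i.e. the
  Caffarelli-Kohn-Nirenberg inequality itself. It follows from the weighted Hardy inequality and the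
  \<open>L\<^sup>1\<close> Gagliardo-Nirenberg inequality applied to \<open>|x|\<^sup>-\<^sup>\<gamma> |f|\<^sup>s\<close>: bounding the gradient by Cauchy-Schwarz
  and Hardy controls the scale-invariant integral with exponent \<open>s d / (d - 1)\<close> by the one with exponent
  \<open>2 (s - 1)\<close>. In dimension \<open>d \<ge> 3\<close> the critical exponent is a fixed point and is absorbed; for \<open>d = 2\<close>
  one iterates, for \<open>d = 1\<close> there is a uniform bound, and Hoelder interpolation gives the other exponents.
\<close>

subsection \<open>Hoelder inequalities\<close>

lemma Young_weighted:
  fixes x y l :: real
  assumes "0 \<le> x" "0 \<le> y" "0 < l" "l < 1"
  shows "x powr l * y powr (1 - l) \<le> l * x + (1 - l) * y"
proof (cases "x = 0 \<or> y = 0")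
  case False
  then show ?thesis using Youngs_inequality_0[of l "1 - l" x y] assms by auto
qed (use assms in auto)

lemma Holder_integral:
  fixes F G :: "'a \<Rightarrow> real"
  assumes F: "integrable M F" and G: "integrable M G"
    and F0: "\<And>x. 0 \<le> F x" and G0: "\<And>x. 0 \<le> G x" and l: "0 < l" "l < 1"
  shows Holder_integrable: "integrable M (\<lambda>x. F x powr l * G x powr (1 - l))"
    and Holder_integral_le:
      "(\<integral>x. F x powr l * G x powr (1 - l) \<partial>M) \<le> (\<integral>x. F x \<partial>M) powr l * (\<integral>x. G x \<partial>M) powr (1 - l)"
proof -
  have [measurable]: "F \<in> borel_measurable M" "G \<in> borel_measurable M"
    using F G by auto
  show int: "integrable M (\<lambda>x. F x powr l * G x powr (1 - l))"
    by (rule Bochner_Integration.integrable_bound[of M "\<lambda>x. l * F x + (1 - l) * G x"])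
      (use F G Young_weighted[OF F0 G0 l] l F0 G0 in \<open>auto intro!: AE_I2 simp: abs_mult\<close>)
  have A0: "0 \<le> (\<integral>x. F x \<partial>M)" and B0: "0 \<le> (\<integral>x. G x \<partial>M)"
    using F0 G0 by auto
  show "(\<integral>x. F x powr l * G x powr (1 - l) \<partial>M) \<le> (\<integral>x. F x \<partial>M) powr l * (\<integral>x. G x \<partial>M) powr (1 - l)"
  proof (cases "(\<integral>x. F x \<partial>M) = 0 \<or> (\<integral>x. G x \<partial>M) = 0")
    case True
    then have "(AE x in M. F x = 0) \<or> (AE x in M. G x = 0)"
      using integral_nonneg_eq_0_iff_AE[OF F] integral_nonneg_eq_0_iff_AE[OF G] F0 G0 by auto
    then have "AE x in M. F x powr l * G x powr (1 - l) = 0"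
      by auto
    then have "(\<integral>x. F x powr l * G x powr (1 - l) \<partial>M) = 0"
      by (rule integral_eq_zero_AE)
    then show ?thesis by simp
  next
    case False
    define A where "A = (\<integral>x. F x \<partial>M)"
    define B where "B = (\<integral>x. G x \<partial>M)"
    have AB: "0 < A" "0 < B" using False A0 B0 unfolding A_def B_def by auto
    have "(\<integral>x. F x powr l * G x powr (1 - l) \<partial>M)
        \<le> (\<integral>x. (A powr l * B powr (1 - l)) * (l / A * F x + (1 - l) / B * G x) \<partial>M)"
    proof (rule integral_mono)
      fix x
      have "F x powr l * G x powr (1 - l)
        = (A powr l * B powr (1 - l)) * ((F x / A) powr l * (G x / B) powr (1 - l))"
        using AB F0[of x] G0[of x] by (simp add: powr_divide)
      also have "\<dots> \<le> (A powr l * B powr (1 - l)) * (l * (F x / A) + (1 - l) * (G x / B))"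
        by (intro mult_left_mono Young_weighted) (use AB F0[of x] G0[of x] l in auto)
      finally show "F x powr l * G x powr (1 - l)
        \<le> (A powr l * B powr (1 - l)) * (l / A * F x + (1 - l) / B * G x)" by simp
    qed (use int F G in auto)
    also have "\<dots> = (A powr l * B powr (1 - l)) * (l / A * A + (1 - l) / B * B)"
      using F G by (simp add: A_def B_def)
    also have "\<dots> = A powr l * B powr (1 - l)"
      using AB by simp
    finally show ?thesis unfolding A_def B_def .
  qed
qed

definition epow :: "ennreal \<Rightarrow> real \<Rightarrow> ennreal" where
  "epow x r = (if x = top then top else ennreal (enn2real x powr r))"

lemma epow_ennreal: "0 \<le> x \<Longrightarrow> epow (ennreal x) r = ennreal (x powr r)"
  by (simp add: epow_def)

lemma epow_top [simp]: "epow top r = top"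
  by (simp add: epow_def)

lemma epow_0 [simp]: "epow 0 r = 0"
  by (simp add: epow_def)

lemma epow_eq_0_iff [simp]: "epow x r = 0 \<longleftrightarrow> x = 0"
  by (cases x) (auto simp: epow_ennreal ennreal_eq_0_iff)

lemma epow_mono: "x \<le> y \<Longrightarrow> 0 \<le> r \<Longrightarrow> epow x r \<le> epow y r"
  by (cases x; cases y) (auto simp: epow_ennreal top_unique intro!: ennreal_leI powr_mono2)

lemma borel_measurable_epow [measurable (raw)]:
  assumes [measurable]: "f \<in> borel_measurable M"
  shows "(\<lambda>x. epow (f x) r) \<in> borel_measurable M"
  unfolding epow_def by (intro measurable_If measurable_compose[OF _ measurable_ennreal]) auto

lemma Holder_nn_integral_prod:
  fixes F :: "'i \<Rightarrow> 'a \<Rightarrow> ennreal"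
  assumes S: "finite S" "S \<noteq> {}" and [measurable]: "\<And>i. i \<in> S \<Longrightarrow> F i \<in> borel_measurable M"
  shows "(\<integral>\<^sup>+x. (\<Prod>i\<in>S. epow (F i x) (1 / card S)) \<partial>M)
      \<le> (\<Prod>i\<in>S. epow (\<integral>\<^sup>+x. F i x \<partial>M) (1 / card S))"
proof -
  let ?m = "1 / real (card S)"
  have m: "card S > 0" using S by (simp add: card_gt_0_iff)
  consider (zero) i where "i \<in> S" "(\<integral>\<^sup>+x. F i x \<partial>M) = 0"
    | (top) i where "i \<in> S" "(\<integral>\<^sup>+x. F i x \<partial>M) = top" "\<And>j. j \<in> S \<Longrightarrow> (\<integral>\<^sup>+x. F j x \<partial>M) \<noteq> 0"
    | (fin) "\<And>j. j \<in> S \<Longrightarrow> (\<integral>\<^sup>+x. F j x \<partial>M) \<noteq> 0" "\<And>j. j \<in> S \<Longrightarrow> (\<integral>\<^sup>+x. F j x \<partial>M) \<noteq> top"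
    by blast
  then show ?thesis
  proof cases
    case zero
    then have "AE x in M. F i x = 0"
      by (subst (asm) nn_integral_0_iff_AE) auto
    then have "AE x in M. (\<Prod>i\<in>S. epow (F i x) ?m) = 0"
      by eventually_elim (use zero S in \<open>auto simp: prod_zero_iff\<close>)
    then have "(\<integral>\<^sup>+x. (\<Prod>i\<in>S. epow (F i x) ?m) \<partial>M) = (\<integral>\<^sup>+x. 0 \<partial>M)"
      by (rule nn_integral_cong_AE)
    then show ?thesis by simp
  next
    case top
    have "(\<Prod>j\<in>S. epow (\<integral>\<^sup>+x. F j x \<partial>M) ?m)
        = epow (\<integral>\<^sup>+x. F i x \<partial>M) ?m * (\<Prod>j\<in>S - {i}. epow (\<integral>\<^sup>+x. F j x \<partial>M) ?m)"
      using S top by (simp add: prod.remove)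
    also have "\<dots> = top"
      using top S by (simp add: ennreal_top_mult prod_zero_iff)
    finally show ?thesis by simp
  next
    case fin
    define c where "c j = enn2real (\<integral>\<^sup>+x. F j x \<partial>M)" for j
    have c: "ennreal (c j) = (\<integral>\<^sup>+x. F j x \<partial>M)" "0 < c j" if "j \<in> S" for j
      using fin[OF that] unfolding c_def
      by (auto simp: less_top enn2real_positive_iff zero_less_iff_neq_zero)
    have "AE x in M. F j x \<noteq> \<infinity>" if "j \<in> S" for j
      by (rule nn_integral_PInf_AE) (use that fin in auto)
    then have fin': "AE x in M. \<forall>j\<in>S. F j x \<noteq> \<infinity>"
      using S by (simp add: AE_finite_all)
    have "(\<integral>\<^sup>+x. (\<Prod>i\<in>S. epow (F i x) ?m) \<partial>M)
        \<le> (\<integral>\<^sup>+x. ennreal (\<Prod>i\<in>S. c i powr ?m) * (\<Sum>i\<in>S. ennreal (1 / (card S * c i)) * F i x) \<partial>M)"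
    proof (rule nn_integral_mono_AE, use fin' in eventually_elim)
      fix x assume f: "\<forall>j\<in>S. F j x \<noteq> \<infinity>"
      define f where "f i = enn2real (F i x)" for i
      have fe: "F i x = ennreal (f i)" "0 \<le> f i" if "i \<in> S" for i
        using f that unfolding f_def by (auto simp: less_top)
      have "(\<Prod>i\<in>S. epow (F i x) ?m) = ennreal (\<Prod>i\<in>S. f i powr ?m)"
        using fe by (simp add: epow_ennreal prod_ennreal cong: prod.cong)
      also have "(\<Prod>i\<in>S. f i powr ?m) = (\<Prod>i\<in>S. c i powr ?m * (f i / c i) powr ?m)"
      proof (rule prod.cong)
        fix i assume i: "i \<in> S"
        show "f i powr ?m = c i powr ?m * (f i / c i) powr ?m"
          using c(2)[OF i] fe(2)[OF i] by (simp add: powr_divide)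
      qed simp
      also have "\<dots> = (\<Prod>i\<in>S. c i powr ?m) * (\<Prod>i\<in>S. f i / c i) powr ?m"
        using c fe by (simp add: prod.distrib prod_powr_distrib less_imp_le)
      also have "\<dots> \<le> (\<Prod>i\<in>S. c i powr ?m) * (\<Sum>i\<in>S. f i / c i / card S)"
        by (intro mult_left_mono arith_geom_mean prod_nonneg) (use S c fe in \<open>auto simp: less_imp_le\<close>)
      also have "(\<Sum>i\<in>S. f i / c i / card S) = (\<Sum>i\<in>S. 1 / (card S * c i) * f i)"
        by (simp add: mult.commute)
      also have "ennreal ((\<Prod>i\<in>S. c i powr ?m) * \<dots>)
          = ennreal (\<Prod>i\<in>S. c i powr ?m) * (\<Sum>i\<in>S. ennreal (1 / (card S * c i) * f i))"
        using c fe by (subst ennreal_mult) (auto intro!: prod_nonneg sum_nonneg sum_ennreal[symmetric]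
            simp: less_imp_le)
      also have "(\<Sum>i\<in>S. ennreal (1 / (card S * c i) * f i)) = (\<Sum>i\<in>S. ennreal (1 / (card S * c i)) * F i x)"
        using c fe by (intro sum.cong) (auto simp: ennreal_mult less_imp_le simp flip: ennreal_mult'')
      finally show "(\<Prod>i\<in>S. epow (F i x) ?m)
        \<le> ennreal (\<Prod>i\<in>S. c i powr ?m) * (\<Sum>i\<in>S. ennreal (1 / (card S * c i)) * F i x)"
        by (simp add: ennreal_leI)
    qed
    also have "\<dots> = ennreal (\<Prod>i\<in>S. c i powr ?m) * (\<Sum>i\<in>S. ennreal (1 / (card S * c i)) * ennreal (c i))"
      by (simp add: nn_integral_cmult nn_integral_sum c cong: sum.cong)
    also have "(\<Sum>i\<in>S. ennreal (1 / (card S * c i)) * ennreal (c i)) = (\<Sum>i\<in>S. ennreal (1 / card S))"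
    proof (rule sum.cong)
      fix i assume "i \<in> S"
      then show "ennreal (1 / (card S * c i)) * ennreal (c i) = ennreal (1 / card S)"
        using c(2)[of i] by (subst ennreal_mult[symmetric]) auto
    qed simp
    also have "\<dots> = 1"
      using m by (subst sum_ennreal) auto
    also have "ennreal (\<Prod>i\<in>S. c i powr ?m) * 1 = (\<Prod>i\<in>S. epow (\<integral>\<^sup>+x. F i x \<partial>M) ?m)"
    proof -
      have "epow (\<integral>\<^sup>+x. F i x \<partial>M) ?m = ennreal (c i powr ?m)" if "i \<in> S" for i
        unfolding c(1)[OF that, symmetric] using c(2)[OF that] by (simp add: epow_ennreal)
      then show ?thesis by (simp add: prod_ennreal cong: prod.cong)
    qed
    finally show ?thesis .
  qed
qed

subsection \<open>The Loomis-Whitney inequality\<close>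

definition line_int :: "'a::euclidean_space \<Rightarrow> ('a \<Rightarrow> ennreal) \<Rightarrow> 'a \<Rightarrow> ennreal" where
  "line_int e f x = (\<integral>\<^sup>+t. f (x + t *\<^sub>R e) \<partial>lborel)"

lemma borel_measurable_line_int [measurable]:
  assumes [measurable]: "f \<in> borel_measurable borel"
  shows "line_int e f \<in> borel_measurable borel"
  unfolding line_int_def
  by (rule lborel.borel_measurable_nn_integral) measurable

lemma line_int_commute:
  assumes [measurable]: "f \<in> borel_measurable borel"
  shows "line_int e (line_int e' f) = line_int e' (line_int e f)"
proof
  fix x
  have "line_int e (line_int e' f) x = (\<integral>\<^sup>+t. \<integral>\<^sup>+s. f (x + t *\<^sub>R e + s *\<^sub>R e') \<partial>lborel \<partial>lborel)"
    by (simp add: line_int_def)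
  also have "\<dots> = (\<integral>\<^sup>+s. \<integral>\<^sup>+t. f (x + t *\<^sub>R e + s *\<^sub>R e') \<partial>lborel \<partial>lborel)"
    by (rule lborel_pair.Fubini') measurable
  also have "\<dots> = line_int e' (line_int e f) x"
    by (simp add: line_int_def add_ac)
  finally show "line_int e (line_int e' f) x = line_int e' (line_int e f) x" .
qed

lemma line_int_shift:
  assumes [measurable]: "f \<in> borel_measurable borel"
  shows "line_int e f (x + s *\<^sub>R e) = line_int e f x"
  unfolding line_int_def
  by (subst (2) nn_integral_real_affine[of _ 1 s]) (auto simp: algebra_simps)

lemma line_int_mono: "(\<And>x. f x \<le> g x) \<Longrightarrow> line_int e f x \<le> line_int e g x"
  unfolding line_int_def by (intro nn_integral_mono)

lemma borel_measurable_foldr_line_int [measurable]: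
  "f \<in> borel_measurable borel \<Longrightarrow> foldr line_int es f \<in> borel_measurable borel"
  by (induction es) auto

lemma foldr_line_int_eq_PiM:
  fixes f :: "'a::euclidean_space \<Rightarrow> ennreal"
  assumes [measurable]: "f \<in> borel_measurable borel" and "distinct es" "set es \<subseteq> Basis"
  shows "foldr line_int es f x
    = (\<integral>\<^sup>+y. f (x + (\<Sum>b\<in>set es. y b *\<^sub>R b)) \<partial>Pi\<^sub>M (set es) (\<lambda>_. lborel))"
  using assms(2,3)
proof (induction es arbitrary: x)
  case Nil
  show ?case by (simp add: PiM_empty)
next
  case (Cons e es)
  interpret product_sigma_finite "\<lambda>_::'a. lborel :: real measure" ..
  have e: "e \<notin> set es" using Cons by auto
  have [measurable]: "(\<lambda>y. f (x + (\<Sum>b\<in>set (e # es). y b *\<^sub>R b)))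
      \<in> borel_measurable (Pi\<^sub>M (insert e (set es)) (\<lambda>_. lborel))" for x
    by measurable
  have "foldr line_int (e # es) f x
      = (\<integral>\<^sup>+t. \<integral>\<^sup>+y. f (x + t *\<^sub>R e + (\<Sum>b\<in>set es. y b *\<^sub>R b)) \<partial>Pi\<^sub>M (set es) (\<lambda>_. lborel) \<partial>lborel)"
    using Cons by (simp add: line_int_def[of e])
  also have "\<dots> = (\<integral>\<^sup>+t. \<integral>\<^sup>+y. f (x + (\<Sum>b\<in>set (e # es). (y(e := t)) b *\<^sub>R b)) \<partial>Pi\<^sub>M (set es) (\<lambda>_. lborel) \<partial>lborel)"
  proof -
    have "(\<Sum>b\<in>set es. (y(e := t)) b *\<^sub>R b) = (\<Sum>b\<in>set es. y b *\<^sub>R b)" for y :: "'a \<Rightarrow> real" and t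
      using e by (intro sum.cong) auto
    then show ?thesis
      using e by (simp add: add_ac del: fun_upd_apply) (simp add: add_ac)
  qed
  also have "\<dots> = (\<integral>\<^sup>+y. f (x + (\<Sum>b\<in>set (e # es). y b *\<^sub>R b)) \<partial>Pi\<^sub>M (insert e (set es)) (\<lambda>_. lborel))"
    by (rule product_nn_integral_insert_rev[symmetric]) (use e in auto)
  finally show ?case by simp
qed

lemma nn_integral_lborel_eq_foldr:
  fixes f :: "'a::euclidean_space \<Rightarrow> ennreal"
  assumes [measurable]: "f \<in> borel_measurable borel" and es: "distinct es" "set es = Basis"
  shows "(\<integral>\<^sup>+x. f x \<partial>lborel) = foldr line_int es f 0"
proof -
  have "(\<integral>\<^sup>+x. f x \<partial>lborel) = (\<integral>\<^sup>+x. f x \<partial>distr (\<Pi>\<^sub>M b\<in>Basis. lborel) borel (\<lambda>f. \<Sum>b\<in>Basis. f b *\<^sub>R b))"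
    by (subst lborel_eq) simp
  also have "\<dots> = (\<integral>\<^sup>+y. f (\<Sum>b\<in>Basis. y b *\<^sub>R b) \<partial>(\<Pi>\<^sub>M b\<in>Basis. lborel))"
    by (rule nn_integral_distr) measurable
  also have "\<dots> = foldr line_int es f 0"
    using es by (subst foldr_line_int_eq_PiM) auto
  finally show ?thesis .
qed

lemma foldr_line_int_prod_le:
  fixes g :: "'a::euclidean_space \<Rightarrow> ennreal"
  assumes [measurable]: "g \<in> borel_measurable borel" and d: "2 \<le> DIM('a)"
    and "distinct js" "set js \<subseteq> Basis"
  shows "foldr line_int js (\<lambda>x. \<Prod>i\<in>Basis. epow (line_int i g x) (1 / (real DIM('a) - 1))) x
    \<le> (\<Prod>i\<in>Basis. epow (if i \<in> set js then foldr line_int js g x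
                             else line_int i (foldr line_int js g) x) (1 / (real DIM('a) - 1)))"
  using assms(3,4)
proof (induction js arbitrary: x)
  case Nil
  then show ?case by simp
next
  case (Cons j js)
  let ?m = "1 / (real DIM('a) - 1)"
  define A where "A = foldr line_int js g"
  define B where "B i = (if i \<in> set js then A else line_int i A)" for i
  have [measurable]: "A \<in> borel_measurable borel" unfolding A_def by measurable
  have [measurable]: "B i \<in> borel_measurable borel" for i unfolding B_def by simp
  have j: "j \<in> Basis" "j \<notin> set js" using Cons by auto
  have card: "real (card (Basis - {j})) = real DIM('a) - 1" and ne: "Basis - {j} \<noteq> {}"
    using j d by (auto simp: card_Diff_singleton of_nat_diff)
      (metis One_nat_def card.empty card.insert card_mono empty_iff finite.emptyI finite_insert
        finite_subset insert_absorb not_less_eq_eq numeral_2_eq_2 subset_insertI2 subset_singletonD)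
  have "foldr line_int (j # js) (\<lambda>x. \<Prod>i\<in>Basis. epow (line_int i g x) ?m) x
      \<le> line_int j (\<lambda>x. \<Prod>i\<in>Basis. epow (B i x) ?m) x"
    unfolding foldr.simps o_def
  proof (rule line_int_mono)
    fix y
    have "(if i \<in> set js then A y else line_int i A y) = B i y" for i
      by (simp add: B_def)
    then show "foldr line_int js (\<lambda>x. \<Prod>i\<in>Basis. epow (line_int i g x) ?m) y
        \<le> (\<Prod>i\<in>Basis. epow (B i y) ?m)"
      using Cons.IH[of y, folded A_def] Cons.prems by simp
  qed
  also have "\<dots> = (\<integral>\<^sup>+t. epow (line_int j A x) ?m * (\<Prod>i\<in>Basis - {j}. epow (B i (x + t *\<^sub>R j)) ?m) \<partial>lborel)"
    unfolding line_int_def[of _ "\<lambda>x. \<Prod>i\<in>Basis. epow (B i x) ?m"]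
    by (subst prod.remove[OF _ j(1)]) (auto simp: B_def j line_int_shift)
  also have "\<dots> = epow (line_int j A x) ?m * (\<integral>\<^sup>+t. (\<Prod>i\<in>Basis - {j}. epow (B i (x + t *\<^sub>R j)) ?m) \<partial>lborel)"
    by (rule nn_integral_cmult) measurable
  also have "\<dots> \<le> epow (line_int j A x) ?m * (\<Prod>i\<in>Basis - {j}. epow (\<integral>\<^sup>+t. B i (x + t *\<^sub>R j) \<partial>lborel) ?m)"
    using Holder_nn_integral_prod[of "Basis - {j}" "\<lambda>i t. B i (x + t *\<^sub>R j)" lborel] ne card
    by (intro mult_left_mono) auto
  also have "(\<Prod>i\<in>Basis - {j}. epow (\<integral>\<^sup>+t. B i (x + t *\<^sub>R j) \<partial>lborel) ?m)
     = (\<Prod>i\<in>Basis - {j}. epow (if i \<in> set (j # js) then line_int j A x else line_int i (line_int j A) x) ?m)"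
  proof (rule prod.cong)
    fix i assume i: "i \<in> Basis - {j}"
    have "(\<integral>\<^sup>+t. B i (x + t *\<^sub>R j) \<partial>lborel) = line_int j (B i) x"
      by (simp add: line_int_def)
    also have "\<dots> = (if i \<in> set (j # js) then line_int j A x else line_int i (line_int j A) x)"
      using i by (auto simp: B_def line_int_commute[of A i j])
    finally show "epow (\<integral>\<^sup>+t. B i (x + t *\<^sub>R j) \<partial>lborel) ?m
      = epow (if i \<in> set (j # js) then line_int j A x else line_int i (line_int j A) x) ?m" by simp
  qed simp
  also have "epow (line_int j A x) ?m * \<dots>
    = (\<Prod>i\<in>Basis. epow (if i \<in> set (j # js) then line_int j A x else line_int i (line_int j A) x) ?m)"
    using prod.remove[OF finite_Basis j(1), of
        "\<lambda>i. epow (if i \<in> set (j # js) then line_int j A x else line_int i (line_int j A) x) ?m"]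
    by simp
  also have "line_int j A = foldr line_int (j # js) g" by (simp add: A_def)
  finally show ?case .
qed

lemma Loomis_Whitney:
  fixes g :: "'a::euclidean_space \<Rightarrow> ennreal"
  assumes [measurable]: "g \<in> borel_measurable borel" and d: "2 \<le> DIM('a)"
  shows "(\<integral>\<^sup>+x. (\<Prod>i\<in>Basis. epow (line_int i g x) (1 / (real DIM('a) - 1))) \<partial>lborel)
    \<le> epow (\<integral>\<^sup>+x. g x \<partial>lborel) (1 / (real DIM('a) - 1)) ^ DIM('a)"
proof -
  obtain es :: "'a list" where es: "set es = Basis" "distinct es"
    using finite_distinct_list[OF finite_Basis] by blast
  show ?thesis
    using foldr_line_int_prod_le[of g es 0] es d
    by (simp add: nn_integral_lborel_eq_foldr[of _ es])
qed

subsection \<open>Compactly supported functions of class \<open>C\<^sup>1\<close>\<close>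

definition C1c :: "('a::euclidean_space \<Rightarrow> real) \<Rightarrow> ('a \<Rightarrow> 'a) \<Rightarrow> bool" where
  "C1c f G \<longleftrightarrow> continuous_on UNIV f \<and> continuous_on UNIV G \<and>
     (\<exists>K. compact K \<and> 0 \<notin> K \<and> (\<forall>x. x \<notin> K \<longrightarrow> f x = 0 \<and> G x = 0)) \<and>
     (\<forall>x. \<forall>e\<in>Basis. ((\<lambda>t. f (x + t *\<^sub>R e)) has_real_derivative G x \<bullet> e) (at 0))"

lemma has_real_derivative_line:
  fixes F D :: "'a::euclidean_space \<Rightarrow> real"
  assumes "\<And>x. ((\<lambda>t. F (x + t *\<^sub>R e)) has_real_derivative D x) (at 0)"
  shows "((\<lambda>t. F (x + t *\<^sub>R e)) has_real_derivative D (x + t *\<^sub>R e)) (at t)"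
proof -
  have "((\<lambda>s. F (x + (s + t) *\<^sub>R e)) has_real_derivative D (x + t *\<^sub>R e)) (at 0)"
    using assms[of "x + t *\<^sub>R e"] by (simp add: scaleR_add_left add_ac)
  then show ?thesis
    by (subst DERIV_shift[where x=0 and z=t, simplified])
qed

lemma integrable_continuous_compact:
  fixes h :: "'a::euclidean_space \<Rightarrow> 'b::{banach, second_countable_topology}"
  assumes "continuous_on UNIV h" "compact K" "\<And>x. x \<notin> K \<Longrightarrow> h x = 0"
  shows "integrable lborel h"
proof -
  have "integrable lborel (\<lambda>x. indicator K x *\<^sub>R h x)"
    using assms by (intro borel_integrable_compact) (auto intro: continuous_on_subset)
  moreover have "(\<lambda>x. indicator K x *\<^sub>R h x) = h"
    using assms(3) by (auto simp: indicator_def fun_eq_iff)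
  ultimately show ?thesis by simp
qed

lemma continuous_on_UNIV_zero_near_0:
  fixes h :: "'a::euclidean_space \<Rightarrow> 'b::topological_space"
  assumes "continuous_on (- {0}) h" "compact K" "0 \<notin> K" "\<And>x. x \<notin> K \<Longrightarrow> h x = c"
  shows "continuous_on UNIV h"
proof -
  have "continuous_on (- K) h"
    by (rule continuous_on_eq[of _ "\<lambda>_. c"]) (use assms in auto)
  then have "continuous_on (- {0} \<union> - K) h"
    using assms by (intro continuous_on_open_Un) (auto simp: compact_imp_closed)
  moreover have "- {0} \<union> - K = UNIV" using assms by auto
  ultimately show ?thesis by simp
qed

lemma integral_translate:
  fixes h :: "'a::euclidean_space \<Rightarrow> real"
  assumes [measurable]: "h \<in> borel_measurable borel"
  shows "(\<integral>x. h (x + c) \<partial>lborel) = (\<integral>x. h x \<partial>lborel)"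
  using integral_distr[of "(+) c" lborel borel h] by (simp add: lborel_distr_plus add.commute)

lemma integral_directional_derivative_eq_0:
  fixes F D :: "'a::euclidean_space \<Rightarrow> real"
  assumes F: "continuous_on UNIV F" and D: "continuous_on UNIV D" and K: "compact K"
    and zero: "\<And>x. x \<notin> K \<Longrightarrow> F x = 0" "\<And>x. x \<notin> K \<Longrightarrow> D x = 0"
    and deriv: "\<And>x. ((\<lambda>t. F (x + t *\<^sub>R e)) has_real_derivative D x) (at 0)"
  shows "(\<integral>x. D x \<partial>lborel) = 0"
proof -
  have [measurable]: "F \<in> borel_measurable borel" "D \<in> borel_measurable borel"
    using F D by (auto intro: borel_measurable_continuous_onI)
  obtain B where B: "\<And>x. x \<in> K \<Longrightarrow> norm x \<le> B"
    using K compact_imp_bounded bounded_iff by metis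
  define R where "R = B + norm e"
  have D0: "D (x + s *\<^sub>R e) = 0" if "s \<in> {0..1}" "norm x > R" for x s
  proof -
    have "norm x \<le> norm (x + s *\<^sub>R e) + norm (s *\<^sub>R e)"
      using norm_triangle_ineq4[of "x + s *\<^sub>R e" "s *\<^sub>R e"] by simp
    also have "norm (s *\<^sub>R e) \<le> norm e"
      using that by (simp add: mult_left_le_one_le)
    finally have "norm (x + s *\<^sub>R e) > B" using that by (simp add: R_def)
    then have "x + s *\<^sub>R e \<notin> K" using B[of "x + s *\<^sub>R e"] by auto
    then show ?thesis by (rule zero(2))
  qed
  have "integrable lborel (\<lambda>z. indicator ({0..1} \<times> cball 0 R) z *\<^sub>R D (snd z + fst z *\<^sub>R e))"
    by (intro borel_integrable_compact compact_Times continuous_intros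
        continuous_on_compose2[OF D]) auto
  also have "(\<lambda>z. indicator ({0..1} \<times> cball 0 R) z *\<^sub>R D (snd z + fst z *\<^sub>R e))
      = (\<lambda>(s, x). indicator {0..1} s * D (x + s *\<^sub>R e))"
    using D0 by (auto simp: fun_eq_iff indicator_def)
  finally have int: "integrable (lborel \<Otimes>\<^sub>M lborel) (\<lambda>(s, x). indicator {0..1} s * D (x + s *\<^sub>R e))"
    by (simp only: lborel_prod)
  have iF: "integrable lborel F"
    by (rule integrable_continuous_compact[OF F K]) (use zero in auto)
  have iF': "integrable lborel (\<lambda>x. F (x + e))"
    using integrable_distr[of "(+) e" lborel borel F] iF by (simp add: lborel_distr_plus add.commute)
  have "(\<integral>x. D x \<partial>lborel) = (\<integral>s. indicator {0..1::real} s * (\<integral>x. D x \<partial>lborel) \<partial>lborel)"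
    by simp
  also have "\<dots> = (\<integral>s. \<integral>x. indicator {0..1} s * D (x + s *\<^sub>R e) \<partial>lborel \<partial>lborel)"
    by (simp add: integral_translate)
  also have "\<dots> = (\<integral>x. \<integral>s. indicator {0..1} s * D (x + s *\<^sub>R e) \<partial>lborel \<partial>lborel)"
    using lborel_pair.Fubini_integral[OF int] by simp
  also have "\<dots> = (\<integral>x. F (x + e) - F x \<partial>lborel)"
  proof (rule Bochner_Integration.integral_cong)
    fix x :: 'a
    have cont_line: "continuous_on UNIV (\<lambda>s. D (x + s *\<^sub>R e))"
      by (intro continuous_on_compose2[OF D] continuous_intros) auto
    have "(\<integral>s. D (x + s *\<^sub>R e) * indicator {0..1} s \<partial>lborel) = F (x + 1 *\<^sub>R e) - F (x + 0 *\<^sub>R e)"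
    proof (rule integral_FTC_Icc_real)
      show "isCont (\<lambda>s. D (x + s *\<^sub>R e)) t" for t
        using cont_line by (simp add: continuous_on_eq_continuous_at)
    qed (use has_real_derivative_line[OF deriv] in auto)
    then show "(\<integral>s. indicator {0..1} s * D (x + s *\<^sub>R e) \<partial>lborel) = F (x + e) - F x"
      by (simp add: mult.commute)
  qed simp
  also have "\<dots> = 0"
    using iF iF' by (simp add: integral_translate)
  finally show ?thesis .
qed

lemma C1c_abs_le_line_int:
  fixes f :: "'a::euclidean_space \<Rightarrow> real"
  assumes C: "C1c f G" and e: "e \<in> Basis"
  shows "ennreal \<bar>f x\<bar> \<le> line_int e (\<lambda>y. ennreal (norm (G y))) x"
proof -
  have f: "continuous_on UNIV f" and G: "continuous_on UNIV G"
    and D: "\<And>x. ((\<lambda>t. f (x + t *\<^sub>R e)) has_real_derivative G x \<bullet> e) (at 0)"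
    using C e unfolding C1c_def by auto
  obtain K where K: "compact K" "\<And>x. x \<notin> K \<Longrightarrow> f x = 0"
    using C unfolding C1c_def by auto
  obtain B where B: "\<And>x. x \<in> K \<Longrightarrow> norm x \<le> B"
    using K compact_imp_bounded bounded_iff by metis
  define R where "R = \<bar>B\<bar> + norm x + 1"
  have R0: "R \<ge> 0" unfolding R_def by simp
  have "norm (x + (- R) *\<^sub>R e) = norm (R *\<^sub>R e - x)"
    by (simp add: norm_minus_commute)
  then have "norm (x + (- R) *\<^sub>R e) \<ge> R - norm x"
    using norm_triangle_ineq2[of "R *\<^sub>R e" x] e R0 by simp
  then have "x + (- R) *\<^sub>R e \<notin> K"
    using B[of "x + (- R) *\<^sub>R e"] unfolding R_def by auto
  then have f0: "f (x + (- R) *\<^sub>R e) = 0" using K by auto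
  have R: "- R \<le> 0" using R0 by simp
  have "continuous_on UNIV (\<lambda>t. G (x + t *\<^sub>R e) \<bullet> e)"
    by (intro continuous_on_compose2[OF G] continuous_intros) auto
  then have cont: "isCont (\<lambda>t. G (x + t *\<^sub>R e) \<bullet> e) t" for t
    by (simp add: continuous_on_eq_continuous_at)
  have FTC: "has_bochner_integral lborel (\<lambda>t. (G (x + t *\<^sub>R e) \<bullet> e) * indicator {-R..0} t)
      (f (x + 0 *\<^sub>R e) - f (x + (- R) *\<^sub>R e))"
    by (rule has_bochner_integral_FTC_Icc_real[OF R])
      (use has_real_derivative_line[OF D] cont in auto)
  then have "ennreal \<bar>f x\<bar> = ennreal (norm (\<integral>t. (G (x + t *\<^sub>R e) \<bullet> e) * indicator {-R..0} t \<partial>lborel))"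
    using f0 by (simp add: has_bochner_integral_iff)
  also have "\<dots> \<le> (\<integral>\<^sup>+t. ennreal (norm ((G (x + t *\<^sub>R e) \<bullet> e) * indicator {-R..0} t)) \<partial>lborel)"
    using FTC by (intro integral_norm_bound_ennreal) (auto simp: has_bochner_integral_iff)
  also have "\<dots> \<le> line_int e (\<lambda>y. ennreal (norm (G y))) x"
    unfolding line_int_def
    by (intro nn_integral_mono ennreal_leI) (use e in \<open>auto simp: indicator_def Basis_le_norm\<close>)
  finally show ?thesis .
qed

lemma C1c_integrable_grad: "C1c f G \<Longrightarrow> integrable lborel (\<lambda>x. norm (G x))"
  unfolding C1c_def by (auto intro!: integrable_continuous_compact continuous_intros)

lemma prod_mono_ennreal:
  fixes f g :: "'i \<Rightarrow> ennreal"
  shows "(\<And>i. i \<in> A \<Longrightarrow> f i \<le> g i) \<Longrightarrow> prod f A \<le> prod g A"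
  by (induction A rule: infinite_finite_induct) (auto intro!: mult_mono)

lemma Gagliardo_Nirenberg:
  fixes f :: "'a::euclidean_space \<Rightarrow> real"
  assumes C: "C1c f G" and d: "2 \<le> DIM('a)"
  defines "r \<equiv> real DIM('a) / (real DIM('a) - 1)"
  shows "(\<integral>x. \<bar>f x\<bar> powr r \<partial>lborel) \<le> (\<integral>x. norm (G x) \<partial>lborel) powr r"
proof -
  let ?m = "1 / (real DIM('a) - 1)"
  have [measurable]: "f \<in> borel_measurable borel" "G \<in> borel_measurable borel"
    using C by (auto simp: C1c_def intro: borel_measurable_continuous_onI)
  have pow: "(y powr ?m) ^ DIM('a) = y powr r" if "0 \<le> y" for y :: real
    using that by (cases "y = 0") (auto simp: r_def powr_powr simp flip: powr_realpow)
  have "ennreal (\<integral>x. \<bar>f x\<bar> powr r \<partial>lborel) \<le> (\<integral>\<^sup>+x. ennreal (\<bar>f x\<bar> powr r) \<partial>lborel)"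
    using integral_norm_bound_ennreal[of lborel "\<lambda>x. \<bar>f x\<bar> powr r"]
    by (cases "integrable lborel (\<lambda>x. \<bar>f x\<bar> powr r)") (auto simp: not_integrable_integral_eq)
  also have "\<dots> = (\<integral>\<^sup>+x. (\<Prod>i\<in>(Basis::'a set). epow (ennreal \<bar>f x\<bar>) ?m) \<partial>lborel)"
    by (simp add: epow_ennreal pow ennreal_power)
  also have "\<dots> \<le> (\<integral>\<^sup>+x. (\<Prod>i\<in>Basis. epow (line_int i (\<lambda>y. ennreal (norm (G y))) x) ?m) \<partial>lborel)"
    by (intro nn_integral_mono prod_mono_ennreal epow_mono C1c_abs_le_line_int[OF C])
      (use d in auto)
  also have "\<dots> \<le> epow (\<integral>\<^sup>+x. ennreal (norm (G x)) \<partial>lborel) ?m ^ DIM('a)"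
    using Loomis_Whitney[of "\<lambda>y. ennreal (norm (G y))"] d by simp
  also have "(\<integral>\<^sup>+x. ennreal (norm (G x)) \<partial>lborel) = ennreal (\<integral>x. norm (G x) \<partial>lborel)"
    by (intro nn_integral_eq_integral C1c_integrable_grad[OF C]) auto
  also have "epow \<dots> ?m ^ DIM('a) = ennreal ((\<integral>x. norm (G x) \<partial>lborel) powr r)"
    by (simp add: epow_ennreal pow ennreal_power)
  finally show ?thesis by (simp add: ennreal_le_iff)
qed

lemma C1c_abs_le_integral_1D:
  fixes f :: "'a::euclidean_space \<Rightarrow> real"
  assumes C: "C1c f G" and d: "DIM('a) = 1"
  shows "\<bar>f x\<bar> \<le> (\<integral>x. norm (G x) \<partial>lborel)"
proof -
  obtain e where e: "(Basis :: 'a set) = {e}"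
    using d card_1_singletonE by blast
  let ?g = "\<lambda>y. ennreal (norm (G y))"
  have [measurable]: "G \<in> borel_measurable borel"
    using C by (auto simp: C1c_def intro: borel_measurable_continuous_onI)
  have x: "x = 0 + (x \<bullet> e) *\<^sub>R e"
    using euclidean_representation[of x] unfolding e by simp
  have "ennreal \<bar>f x\<bar> \<le> line_int e ?g x"
    by (rule C1c_abs_le_line_int[OF C]) (simp add: e)
  also have "\<dots> = line_int e ?g 0"
    by (subst x, rule line_int_shift) simp
  also have "\<dots> = (\<integral>\<^sup>+x. ?g x \<partial>lborel)"
    using e by (subst nn_integral_lborel_eq_foldr[of _ "[e]"]) auto
  also have "\<dots> = ennreal (\<integral>x. norm (G x) \<partial>lborel)"
    by (intro nn_integral_eq_integral C1c_integrable_grad[OF C]) auto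
  finally show ?thesis by (simp add: ennreal_le_iff)
qed

lemma C1c_diff:
  assumes "C1c f G" "C1c h H"
  shows "C1c (\<lambda>x. f x - h x) (\<lambda>x. G x - H x)"
proof -
  obtain K where K: "compact K" "0 \<notin> K" "\<And>x. x \<notin> K \<Longrightarrow> f x = 0 \<and> G x = 0"
    using assms(1) unfolding C1c_def by auto
  obtain L where L: "compact L" "0 \<notin> L" "\<And>x. x \<notin> L \<Longrightarrow> h x = 0 \<and> H x = 0"
    using assms(2) unfolding C1c_def by auto
  have "compact (K \<union> L) \<and> 0 \<notin> K \<union> L \<and> (\<forall>x. x \<notin> K \<union> L \<longrightarrow> f x - h x = 0 \<and> G x - H x = 0)"
    using K L by (auto simp: compact_Un)
  then show ?thesis
    using assms unfolding C1c_def
    by (auto simp: inner_diff_left intro!: continuous_intros derivative_intros)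
qed

lemma has_real_derivative_0_off_compact:
  fixes f :: "'a::euclidean_space \<Rightarrow> real"
  assumes K: "compact K" and x: "x \<notin> K" and f: "\<And>y. y \<notin> K \<Longrightarrow> f y = 0"
  shows "((\<lambda>t. f (x + t *\<^sub>R e)) has_real_derivative 0) (at 0)"
proof (rule has_field_derivative_transform_within_open)
  show "open ((\<lambda>t. x + t *\<^sub>R e) -` (- K))"
    by (intro open_vimage continuous_intros open_Compl compact_imp_closed K)
  show "((\<lambda>_. 0) has_real_derivative 0) (at 0)" by simp
qed (use x f in auto)

lemma test_fun_imp_C1c:
  fixes \<phi> :: "'a::euclidean_space \<Rightarrow> real"
  assumes "test_fun \<phi>"
  shows "C1c \<phi> (grad \<phi>)"
proof -
  define K where "K = closure {x. \<phi> x \<noteq> 0}"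
  have K: "compact K" "0 \<notin> K" and sm: "smooth_on (UNIV - {0}) \<phi>"
    using assms by (auto simp: test_fun_def K_def)
  have phi0: "\<phi> x = 0" if "x \<notin> K" for x
    using that closure_subset[of "{x. \<phi> x \<noteq> 0}"] unfolding K_def by auto
  have d0: "((\<lambda>t. \<phi> (x + t *\<^sub>R e)) has_real_derivative 0) (at 0)" if "x \<notin> K" for x e
    using has_real_derivative_0_off_compact[OF K(1) that phi0] .
  have g0: "pderiv_list [e] \<phi> x = 0" if "x \<notin> K" for x e
    using DERIV_imp_deriv[OF d0[OF that]] by simp
  have ge: "grad \<phi> x \<bullet> e = pderiv_list [e] \<phi> x" if "e \<in> Basis" for x e
    using that unfolding grad_def by (simp add: inner_sum_left_Basis del: pderiv_list.simps)
  have gr0: "grad \<phi> x = 0" if "x \<notin> K" for x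
    unfolding grad_def by (intro sum.neutral ballI) (simp add: g0[OF that] del: pderiv_list.simps)
  have sm': "continuous_on (- {0}) (pderiv_list es \<phi>)"
    "\<And>e x. e \<in> Basis \<Longrightarrow> x \<noteq> 0 \<Longrightarrow>
      ((\<lambda>t. pderiv_list es \<phi> (x + t *\<^sub>R e)) has_real_derivative pderiv_list (e # es) \<phi> x) (at 0)"
    if "set es \<subseteq> Basis" for es
    using sm that unfolding smooth_on_def by (auto simp: Compl_eq_Diff_UNIV simp del: pderiv_list.simps)
  have "continuous_on UNIV \<phi>"
    using sm'(1)[of "[]"] K phi0 by (intro continuous_on_UNIV_zero_near_0[of \<phi> K 0]) auto
  moreover have "continuous_on UNIV (grad \<phi>)"
  proof (rule continuous_on_UNIV_zero_near_0[OF _ K gr0])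
    show "continuous_on (- {0}) (grad \<phi>)"
      unfolding grad_def using sm'(1) by (intro continuous_intros) (auto simp del: pderiv_list.simps)
  qed
  moreover have "((\<lambda>t. \<phi> (x + t *\<^sub>R e)) has_real_derivative grad \<phi> x \<bullet> e) (at 0)" if "e \<in> Basis" for x e
  proof (cases "x = 0")
    case True
    then show ?thesis using d0[OF K(2)] gr0[OF K(2)] by simp
  next
    case False
    then show ?thesis using sm'(2)[of "[]" e x] that by (simp add: ge del: pderiv_list.simps(2))
  qed
  ultimately show ?thesis
    unfolding C1c_def using K phi0 gr0 by auto
qed

definition spow :: "real \<Rightarrow> real \<Rightarrow> real" where
  "spow s y = max y 0 powr s - max (- y) 0 powr s"

lemma abs_spow: "\<bar>spow s y\<bar> = \<bar>y\<bar> powr s"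
  by (auto simp: spow_def max_def)

lemma spow_1: "spow 1 y = y"
  by (auto simp: spow_def max_def)

lemma continuous_on_spow [continuous_intros]:
  assumes "continuous_on S f" "0 < s"
  shows "continuous_on S (\<lambda>x. spow s (f x))"
  unfolding spow_def using assms by (intro continuous_intros continuous_on_powr') auto

lemma has_real_derivative_abs_powr:
  fixes s :: real
  assumes s: "1 < s"
  shows "((\<lambda>y. \<bar>y\<bar> powr s) has_real_derivative s * spow (s - 1) y) (at y)"
proof -
  consider "0 < y" | "y < 0" | "y = 0" by linarith
  then show ?thesis
  proof cases
    case 1
    have "((\<lambda>y. y powr s) has_real_derivative s * spow (s - 1) y) (at y)"
      using 1 by (auto intro!: derivative_eq_intros simp: spow_def max_def)
    then show ?thesis
      by (rule has_field_derivative_transform_within_open[of _ _ _ "{0<..}"]) (use 1 in auto)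
  next
    case 2
    have "((\<lambda>y. (- y) powr s) has_real_derivative s * spow (s - 1) y) (at y)"
      using 2 by (auto intro!: derivative_eq_intros simp: spow_def max_def)
    then show ?thesis
      by (rule has_field_derivative_transform_within_open[of _ _ _ "{..<0}"]) (use 2 in auto)
  next
    case 3
    have "continuous_on UNIV (\<lambda>h::real. \<bar>h\<bar> powr (s - 1))"
      using s by (intro continuous_on_powr' continuous_intros) auto
    then have "isCont (\<lambda>h::real. \<bar>h\<bar> powr (s - 1)) 0"
      by (simp add: continuous_on_eq_continuous_at)
    then have "((\<lambda>h::real. \<bar>h\<bar> powr (s - 1)) \<longlongrightarrow> 0) (at 0)"
      by (simp add: isCont_def)
    then have "((\<lambda>h::real. (\<bar>h\<bar> powr s) / h) \<longlongrightarrow> 0) (at 0)"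
    proof (rule Lim_null_comparison[rotated], intro always_eventually allI)
      fix h :: real
      show "norm (\<bar>h\<bar> powr s / h) \<le> \<bar>h\<bar> powr (s - 1)"
        by (cases "h = 0") (auto simp: powr_diff)
    qed
    then show ?thesis
      using 3 by (simp add: DERIV_def spow_def)
  qed
qed

lemma has_real_derivative_norm_powr_line:
  fixes x e :: "'a::euclidean_space"
  assumes "x \<noteq> 0"
  shows "((\<lambda>t. norm (x + t *\<^sub>R e) powr r) has_real_derivative r * norm x powr (r - 2) * (x \<bullet> e)) (at 0)"
proof -
  have eq: "norm y powr r = (y \<bullet> y) powr (r / 2)" for y :: 'a and r
    by (cases "y = 0") (auto simp: power2_norm_eq_inner[symmetric] powr_powr simp flip: powr_numeral)
  have "((\<lambda>t. ((x + t *\<^sub>R e) \<bullet> (x + t *\<^sub>R e)) powr (r / 2)) has_real_derivative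
      r * (x \<bullet> x) powr (r / 2 - 1) * (x \<bullet> e)) (at 0)"
    unfolding inner_add_left inner_add_right inner_scaleR_left inner_scaleR_right
    using assms by (auto intro!: derivative_eq_intros simp: inner_commute[of e x])
  moreover have "norm x powr (r - 2) = (x \<bullet> x) powr (r / 2 - 1)"
    using eq[of x "r - 2"] by (simp add: diff_divide_distrib)
  ultimately show ?thesis by (simp add: eq)
qed

lemma C1c_abs_powr_weight:
  fixes f :: "'a::euclidean_space \<Rightarrow> real"
  assumes C: "C1c f G" and s: "1 < s"
  shows "C1c (\<lambda>x. \<bar>f x\<bar> powr s * norm x powr r)
    (\<lambda>x. (s * spow (s - 1) (f x) * norm x powr r) *\<^sub>R G x + (r * norm x powr (r - 2) * \<bar>f x\<bar> powr s) *\<^sub>R x)"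
    (is "C1c ?h ?H")
proof -
  have f: "continuous_on UNIV f" and G: "continuous_on UNIV G"
    and D: "\<And>x e. e \<in> Basis \<Longrightarrow> ((\<lambda>t. f (x + t *\<^sub>R e)) has_real_derivative G x \<bullet> e) (at 0)"
    using C unfolding C1c_def by auto
  obtain K where K: "compact K" "0 \<notin> K" "\<And>x. x \<notin> K \<Longrightarrow> f x = 0 \<and> G x = 0"
    using C unfolding C1c_def by auto
  have fG: "continuous_on (- {0}) f" "continuous_on (- {0}) G"
    using f G continuous_on_subset by blast+
  have "continuous_on UNIV ?h"
    by (rule continuous_on_UNIV_zero_near_0[OF _ K(1,2), of _ 0])
      (use K s fG in \<open>auto intro!: continuous_intros continuous_on_powr'\<close>)
  moreover have "continuous_on UNIV ?H"
    by (rule continuous_on_UNIV_zero_near_0[OF _ K(1,2), of _ 0])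
      (use K s fG in \<open>auto intro!: continuous_intros continuous_on_powr'\<close>)
  moreover have "((\<lambda>t. ?h (x + t *\<^sub>R e)) has_real_derivative ?H x \<bullet> e) (at 0)" if e: "e \<in> Basis" for x e
  proof (cases "x = 0")
    case False
    have "((\<lambda>t. \<bar>f (x + t *\<^sub>R e)\<bar> powr s) has_real_derivative s * spow (s - 1) (f x) * (G x \<bullet> e)) (at 0)"
      using DERIV_chain2[OF has_real_derivative_abs_powr[OF s] D[OF e, of x]] by simp
    from DERIV_mult[OF this has_real_derivative_norm_powr_line[OF False, of e r]]
    show ?thesis by (simp add: inner_add_left algebra_simps)
  next
    case True
    have "((\<lambda>t. ?h (x + t *\<^sub>R e)) has_real_derivative 0) (at 0)"
      by (rule has_real_derivative_0_off_compact[OF K(1), of x ?h]) (use K True in auto)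
    then show ?thesis using True by simp
  qed
  ultimately show ?thesis
    unfolding C1c_def using K by (auto intro!: exI[of _ K])
qed

lemma C1c_integrable_weighted:
  fixes f :: "'a::euclidean_space \<Rightarrow> real"
  assumes C: "C1c f G" and F: "continuous_on UNIV F" and F0: "\<And>x. f x = 0 \<Longrightarrow> G x = 0 \<Longrightarrow> F x = 0"
  shows "integrable lborel (\<lambda>x. F x * norm x powr r :: real)"
proof -
  obtain K where K: "compact K" "0 \<notin> K" "\<And>x. x \<notin> K \<Longrightarrow> f x = 0 \<and> G x = 0"
    using C unfolding C1c_def by auto
  have "continuous_on (- {0}) F"
    using F continuous_on_subset by blast
  then have "continuous_on UNIV (\<lambda>x. F x * norm x powr r)"
    by (intro continuous_on_UNIV_zero_near_0[OF _ K(1,2), of _ 0])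
      (use K F0 in \<open>auto intro!: continuous_intros\<close>)
  then show ?thesis
    by (rule integrable_continuous_compact[OF _ K(1)]) (use K F0 in auto)
qed

lemma C1c_integrable_powr:
  assumes "C1c f G" "0 < s"
  shows "integrable lborel (\<lambda>x. \<bar>f x\<bar> powr s * norm x powr r)"
  using assms by (intro C1c_integrable_weighted[OF assms(1)])
    (auto simp: C1c_def intro!: continuous_intros continuous_on_powr')

lemma C1c_integrable_grad2:
  assumes "C1c f G"
  shows "integrable lborel (\<lambda>x. (norm (G x))\<^sup>2 * norm x powr r)"
  using assms by (intro C1c_integrable_weighted[OF assms(1)])
    (auto simp: C1c_def intro!: continuous_intros)

subsection \<open>The weighted Hardy inequality\<close>

lemma Cauchy_Schwarz_integral:
  fixes A B :: "'a \<Rightarrow> real"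
  assumes [measurable]: "A \<in> borel_measurable M" "B \<in> borel_measurable M"
    and A: "integrable M (\<lambda>x. (A x)\<^sup>2)" and B: "integrable M (\<lambda>x. (B x)\<^sup>2)"
  shows Cauchy_Schwarz_integrable: "integrable M (\<lambda>x. A x * B x)"
    and Cauchy_Schwarz_integral_le:
      "\<bar>\<integral>x. A x * B x \<partial>M\<bar> \<le> sqrt (\<integral>x. (A x)\<^sup>2 \<partial>M) * sqrt (\<integral>x. (B x)\<^sup>2 \<partial>M)"
proof -
  have eq: "(A x)\<^sup>2 powr (1/2) * (B x)\<^sup>2 powr (1 - 1/2) = norm (A x * B x)" for x
    by (simp add: powr_half_sqrt abs_mult)
  have *: "integrable M (\<lambda>x. norm (A x * B x))"
    "(\<integral>x. norm (A x * B x) \<partial>M) \<le> sqrt (\<integral>x. (A x)\<^sup>2 \<partial>M) * sqrt (\<integral>x. (B x)\<^sup>2 \<partial>M)"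
    using Holder_integral[OF A B, of "1/2"] unfolding eq by (simp_all add: powr_half_sqrt)
  then show "integrable M (\<lambda>x. A x * B x)"
    by (subst (asm) integrable_norm_iff) auto
  then show "\<bar>\<integral>x. A x * B x \<partial>M\<bar> \<le> sqrt (\<integral>x. (A x)\<^sup>2 \<partial>M) * sqrt (\<integral>x. (B x)\<^sup>2 \<partial>M)"
    using order_trans[OF integral_norm_bound *(2)] by simp
qed

lemma C1c_measurable:
  assumes "C1c f G"
  shows "f \<in> borel_measurable borel" "G \<in> borel_measurable borel"
  using assms by (auto simp: C1c_def intro: borel_measurable_continuous_onI)

lemma energy_nonneg: "0 \<le> energy a G"
  unfolding energy_def by (intro integral_nonneg_AE) auto

lemma norm_powr_sq: "(norm x powr r)\<^sup>2 = norm x powr (2 * r)"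
  by (simp add: power2_eq_square flip: powr_add)

lemma Hardy_C1c:
  fixes f :: "'a::euclidean_space \<Rightarrow> real" and a :: real
  assumes C: "C1c f G" and a: "2 * a + 2 < DIM('a)"
  shows "(\<integral>x. \<bar>f x\<bar> powr 2 * norm x powr (- 2 * a - 2) \<partial>lborel)
    \<le> (2 / (real DIM('a) - 2 - 2 * a))\<^sup>2 * energy a G"
proof -
  define r where "r = - 2 * a - 2"
  define h where "h x = \<bar>f x\<bar> powr 2 * norm x powr r" for x
  define H where "H x = (2 * spow (2 - 1) (f x) * norm x powr r) *\<^sub>R G x + (r * norm x powr (r - 2) * \<bar>f x\<bar> powr 2) *\<^sub>R x" for x
  have CH: "C1c h H"
    using C1c_abs_powr_weight[OF C, of 2 r] by (simp add: h_def[abs_def] H_def[abs_def])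
  have [measurable]: "f \<in> borel_measurable borel" "G \<in> borel_measurable borel"
    using C1c_measurable[OF C] .
  have ch: "continuous_on UNIV h" "continuous_on UNIV H"
    and dh: "\<And>x e. e \<in> Basis \<Longrightarrow> ((\<lambda>t. h (x + t *\<^sub>R e)) has_real_derivative H x \<bullet> e) (at 0)"
    using CH unfolding C1c_def by auto
  obtain K where K: "compact K" "\<And>x. x \<notin> K \<Longrightarrow> h x = 0" "\<And>x. x \<notin> K \<Longrightarrow> H x = 0"
    using CH unfolding C1c_def by auto
  have ih: "integrable lborel h"
    using C1c_integrable_powr[OF C, of 2 r] by (simp add: h_def[abs_def])
  have iHe: "integrable lborel (\<lambda>x. (H x \<bullet> e) * (x \<bullet> e))" for e
    by (rule integrable_continuous_compact[OF _ K(1)]) (use ch K in \<open>auto intro!: continuous_intros\<close>)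
  have 0: "(\<integral>x. (H x \<bullet> e) * (x \<bullet> e) + h x \<partial>lborel) = 0" if e: "e \<in> Basis" for e
  proof (rule integral_directional_derivative_eq_0[where F = "\<lambda>x. h x * (x \<bullet> e)" and e = e])
    show "((\<lambda>t. h (x + t *\<^sub>R e) * ((x + t *\<^sub>R e) \<bullet> e)) has_real_derivative H x \<bullet> e * (x \<bullet> e) + h x) (at 0)" for x
      using e by (auto intro!: derivative_eq_intros dh simp: inner_add_left)
  qed (use ch K in \<open>auto intro!: continuous_intros\<close>)
  have Hx: "H x \<bullet> x = 2 * (f x * norm x powr r * (G x \<bullet> x)) + r * h x" for x
  proof (cases "x = 0")
    case False
    then have "norm x powr (r - 2) * (x \<bullet> x) = norm x powr r"
      by (simp add: powr_diff power2_norm_eq_inner[symmetric])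
    then show ?thesis
      by (simp add: H_def h_def inner_add_left spow_1 algebra_simps)
  qed (simp add: H_def h_def)
  have "0 = (\<Sum>e\<in>Basis. \<integral>x. (H x \<bullet> e) * (x \<bullet> e) + h x \<partial>lborel)"
    using 0 by simp
  also have "\<dots> = (\<integral>x. H x \<bullet> x + DIM('a) * h x \<partial>lborel)"
  proof -
    have "(\<Sum>e\<in>Basis. (H x \<bullet> e) * (x \<bullet> e) + h x) = H x \<bullet> x + DIM('a) * h x" for x
      by (subst euclidean_inner) (simp add: sum.distrib)
    then show ?thesis
      using iHe ih by (subst Bochner_Integration.integral_sum[symmetric]) auto
  qed
  also have "\<dots> = (\<integral>x. 2 * (f x * norm x powr r * (G x \<bullet> x)) + (DIM('a) + r) * h x \<partial>lborel)"
    by (simp add: Hx algebra_simps)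
  finally have eq: "(\<integral>x. 2 * (f x * norm x powr r * (G x \<bullet> x)) + (DIM('a) + r) * h x \<partial>lborel) = 0" by simp
  have i1: "integrable lborel (\<lambda>x. f x * norm x powr r * (G x \<bullet> x))"
    using C1c_integrable_weighted[OF C, of "\<lambda>x. f x * (G x \<bullet> x)" r] C
    by (fastforce simp: C1c_def mult_ac intro!: continuous_intros)
  have A: "(\<bar>f x\<bar> * norm x powr (- a - 1))\<^sup>2 = h x" for x
    by (simp add: power_mult_distrib norm_powr_sq h_def r_def)
  have B: "(norm (G x) * norm x powr (- a))\<^sup>2 = (norm (G x))\<^sup>2 * norm x powr (- 2 * a)" for x
    by (simp add: power_mult_distrib norm_powr_sq)
  have CS: "integrable lborel (\<lambda>x. (\<bar>f x\<bar> * norm x powr (- a - 1)) * (norm (G x) * norm x powr (- a)))"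
    "(\<integral>x. (\<bar>f x\<bar> * norm x powr (- a - 1)) * (norm (G x) * norm x powr (- a)) \<partial>lborel)
      \<le> sqrt (\<integral>x. h x \<partial>lborel) * sqrt (energy a G)"
    using Cauchy_Schwarz_integral[of "\<lambda>x. \<bar>f x\<bar> * norm x powr (- a - 1)" lborel
        "\<lambda>x. norm (G x) * norm x powr (- a)"] ih C1c_integrable_grad2[OF C, of "- 2 * a"]
    unfolding A B energy_def by auto
  have "(DIM('a) + r) * (\<integral>x. h x \<partial>lborel) = - 2 * (\<integral>x. f x * norm x powr r * (G x \<bullet> x) \<partial>lborel)"
    using eq i1 ih by simp
  also have "\<dots> \<le> 2 * (\<integral>x. norm (f x * norm x powr r * (G x \<bullet> x)) \<partial>lborel)"
    using integral_norm_bound[of lborel "\<lambda>x. f x * norm x powr r * (G x \<bullet> x)"]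
    unfolding real_norm_def by linarith
  also have "\<dots> \<le> 2 * (\<integral>x. (\<bar>f x\<bar> * norm x powr (- a - 1)) * (norm (G x) * norm x powr (- a)) \<partial>lborel)"
  proof (intro mult_left_mono integral_mono)
    fix x
    have "norm (f x * norm x powr r * (G x \<bullet> x)) \<le> \<bar>f x\<bar> * norm x powr r * (norm (G x) * norm x)"
      by (simp add: abs_mult mult_left_mono Cauchy_Schwarz_ineq2)
    also have "\<dots> = (\<bar>f x\<bar> * norm (G x)) * (norm x powr r * norm x powr 1)"
      by simp
    also have "norm x powr r * norm x powr 1 = norm x powr (- a - 1) * norm x powr (- a)"
      unfolding powr_add[symmetric] r_def by (rule arg_cong[where f = "(powr) (norm x)"]) simp
    finally show "norm (f x * norm x powr r * (G x \<bullet> x))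
      \<le> (\<bar>f x\<bar> * norm x powr (- a - 1)) * (norm (G x) * norm x powr (- a))"
      by (simp add: mult_ac)
  qed (use i1 CS in auto)
  also have "\<dots> \<le> 2 * (sqrt (\<integral>x. h x \<partial>lborel) * sqrt (energy a G))"
    using CS by simp
  finally have fin: "(DIM('a) + r) * (\<integral>x. h x \<partial>lborel) \<le> 2 * (sqrt (\<integral>x. h x \<partial>lborel) * sqrt (energy a G))" .
  define N where "N = sqrt (\<integral>x. h x \<partial>lborel)"
  have "0 \<le> (\<integral>x. h x \<partial>lborel)"
    by (intro integral_nonneg_AE) (auto simp: h_def)
  then have N: "0 \<le> N" "(\<integral>x. h x \<partial>lborel) = N\<^sup>2"
    unfolding N_def by simp_all
  define \<delta> where "\<delta> = real DIM('a) - 2 - 2 * a"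
  have \<delta>: "0 < \<delta>" "DIM('a) + r = \<delta>" using a by (auto simp: \<delta>_def r_def)
  have "N \<le> 2 / \<delta> * sqrt (energy a G)"
  proof (cases "N = 0")
    case False
    then have "\<delta> * N * N \<le> 2 * sqrt (energy a G) * N"
      using fin unfolding \<delta> N(2) by (simp add: N_def[symmetric] power2_eq_square algebra_simps N(1))
    then have "\<delta> * N \<le> 2 * sqrt (energy a G)"
      using False N by simp
    then show ?thesis using \<delta> by (simp add: field_simps)
  qed (use \<delta> energy_nonneg[of a G] in auto)
  then have "N\<^sup>2 \<le> (2 / \<delta> * sqrt (energy a G))\<^sup>2"
    using N by (intro power_mono) auto
  then have "(\<integral>x. h x \<partial>lborel) \<le> (2 / \<delta>)\<^sup>2 * energy a G"
    unfolding N(2)[symmetric] power_mult_distrib using energy_nonneg[of a G] by simp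
  then show ?thesis
    unfolding h_def r_def \<delta>_def .
qed

subsection \<open>The Caffarelli-Kohn-Nirenberg inequality\<close>

definition ckn_wt :: "'a::euclidean_space itself \<Rightarrow> real \<Rightarrow> real \<Rightarrow> real" where
  "ckn_wt _ a p = (a - (real DIM('a) - 2) / 2) * p + real DIM('a)"

definition ckn_int :: "real \<Rightarrow> real \<Rightarrow> ('a::euclidean_space \<Rightarrow> real) \<Rightarrow> real" where
  "ckn_int a p f = (\<integral>x. \<bar>f x\<bar> powr p * norm x powr (- ckn_wt TYPE('a) a p) \<partial>lborel)"

definition ckn_C1c :: "'a::euclidean_space itself \<Rightarrow> real \<Rightarrow> real \<Rightarrow> bool" where
  "ckn_C1c _ a p \<longleftrightarrow>
     (\<exists>C\<ge>0. \<forall>(f :: 'a \<Rightarrow> real) G. C1c f G \<longrightarrow> ckn_int a p f \<le> C * energy a G powr (p / 2))"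

lemma ckn_int_nonneg: "0 \<le> ckn_int a p f"
  unfolding ckn_int_def by (intro integral_nonneg_AE) auto

lemma ckn_wt_2: "- ckn_wt TYPE('a::euclidean_space) a 2 = - 2 * a - 2"
  by (simp add: ckn_wt_def field_simps)

lemma ckn_int_2_le:
  fixes f :: "'a::euclidean_space \<Rightarrow> real"
  assumes "C1c f G" "2 * a + 2 < real DIM('a)"
  shows "ckn_int a 2 f \<le> (2 / (real DIM('a) - 2 - 2 * a))\<^sup>2 * energy a G"
  using Hardy_C1c[OF assms] unfolding ckn_int_def ckn_wt_2 .

lemma ckn_C1c_2:
  assumes "2 * a + 2 < real DIM('a::euclidean_space)"
  shows "ckn_C1c TYPE('a) a 2"
  unfolding ckn_C1c_def
  by (intro exI[of _ "(2 / (real DIM('a) - 2 - 2 * a))\<^sup>2"]) (auto simp: ckn_int_2_le assms energy_nonneg)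

text \<open>The exponent of the weight is the one for which the Cauchy-Schwarz factor is again a
  scale-invariant integral, with exponent \<open>2 * (s - 1)\<close>.\<close>
lemma weighted_power_C1c:
  fixes f :: "'a::euclidean_space \<Rightarrow> real"
  assumes C: "C1c f G" and a: "2 * a + 2 < real DIM('a)" and s: "2 \<le> s"
  defines "\<gamma> \<equiv> (a - (real DIM('a) - 2) / 2) * s + real DIM('a) - 1"
  obtains H where "C1c (\<lambda>x. \<bar>f x\<bar> powr s * norm x powr (- \<gamma>)) H"
    "(\<integral>x. norm (H x) \<partial>lborel) \<le> (s + \<bar>\<gamma>\<bar> * (2 / (real DIM('a) - 2 - 2 * a)))
      * (sqrt (energy a G) * sqrt (ckn_int a (2 * (s - 1)) f))"
proof
  define H where "H x = (s * spow (s - 1) (f x) * norm x powr (- \<gamma>)) *\<^sub>R G x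
    + (- \<gamma> * norm x powr (- \<gamma> - 2) * \<bar>f x\<bar> powr s) *\<^sub>R x" for x
  define k where "k = 2 / (real DIM('a) - 2 - 2 * a)"
  have k: "0 \<le> k" using a by (simp add: k_def)
  show CH: "C1c (\<lambda>x. \<bar>f x\<bar> powr s * norm x powr (- \<gamma>)) H"
    using C1c_abs_powr_weight[OF C, of s "- \<gamma>"] s by (simp add: H_def[abs_def])
  have [measurable]: "f \<in> borel_measurable borel" "G \<in> borel_measurable borel"
    using C1c_measurable[OF C] .
  define A where "A x = norm (G x) * norm x powr (- a)" for x
  define A' where "A' x = \<bar>f x\<bar> * norm x powr (- a - 1)" for x
  define B where "B x = \<bar>f x\<bar> powr (s - 1) * norm x powr (a - \<gamma>)" for x
  have [measurable]: "A \<in> borel_measurable borel" "A' \<in> borel_measurable borel" "B \<in> borel_measurable borel"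
    unfolding A_def A'_def B_def by measurable
  have wt: "2 * (a - \<gamma>) = - ckn_wt TYPE('a) a (2 * (s - 1))"
    by (simp add: \<gamma>_def ckn_wt_def field_simps)
  have A2: "(A x)\<^sup>2 = (norm (G x))\<^sup>2 * norm x powr (- 2 * a)" for x
    by (simp add: A_def power_mult_distrib norm_powr_sq)
  have A'2: "(A' x)\<^sup>2 = \<bar>f x\<bar> powr 2 * norm x powr (- ckn_wt TYPE('a) a 2)" for x
    unfolding ckn_wt_2 by (simp add: A'_def power_mult_distrib norm_powr_sq)
  have B2: "(B x)\<^sup>2 = \<bar>f x\<bar> powr (2 * (s - 1)) * norm x powr (- ckn_wt TYPE('a) a (2 * (s - 1)))" for x
  proof -
    have "(\<bar>f x\<bar> powr (s - 1))\<^sup>2 = \<bar>f x\<bar> powr (2 * (s - 1))"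
      using norm_powr_sq[of "f x" "s - 1"] by simp
    then show ?thesis unfolding B_def power_mult_distrib norm_powr_sq wt by simp
  qed
  have iA: "integrable lborel (\<lambda>x. (A x)\<^sup>2)" "(\<integral>x. (A x)\<^sup>2 \<partial>lborel) = energy a G"
    unfolding A2 energy_def using C1c_integrable_grad2[OF C] by auto
  have iA': "integrable lborel (\<lambda>x. (A' x)\<^sup>2)" "(\<integral>x. (A' x)\<^sup>2 \<partial>lborel) = ckn_int a 2 f"
    unfolding A'2 ckn_int_def using C1c_integrable_powr[OF C, of 2] by auto
  have iB: "integrable lborel (\<lambda>x. (B x)\<^sup>2)" "(\<integral>x. (B x)\<^sup>2 \<partial>lborel) = ckn_int a (2 * (s - 1)) f"
    unfolding B2 ckn_int_def using C1c_integrable_powr[OF C, of "2 * (s - 1)"] s by auto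
  have AB: "integrable lborel (\<lambda>x. A x * B x)"
    "(\<integral>x. A x * B x \<partial>lborel) \<le> sqrt (energy a G) * sqrt (ckn_int a (2 * (s - 1)) f)"
    using Cauchy_Schwarz_integral[of A lborel B] iA iB by auto
  have A'B: "integrable lborel (\<lambda>x. A' x * B x)"
    "(\<integral>x. A' x * B x \<partial>lborel) \<le> sqrt (ckn_int a 2 f) * sqrt (ckn_int a (2 * (s - 1)) f)"
    using Cauchy_Schwarz_integral[of A' lborel B] iA' iB by auto
  have sqrt2: "sqrt (ckn_int a 2 f) \<le> k * sqrt (energy a G)"
    using real_sqrt_le_mono[OF ckn_int_2_le[OF C a]] k unfolding k_def[symmetric]
    by (simp add: real_sqrt_mult)
  have "(\<integral>x. norm (H x) \<partial>lborel) \<le> (\<integral>x. s * (A x * B x) + \<bar>\<gamma>\<bar> * (A' x * B x) \<partial>lborel)"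
  proof (rule integral_mono)
    fix x
    have "norm (H x) \<le> s * (\<bar>f x\<bar> powr (s - 1) * norm x powr (- \<gamma>) * norm (G x))
        + \<bar>\<gamma>\<bar> * (norm x powr (- \<gamma> - 2) * norm x * \<bar>f x\<bar> powr s)"
      unfolding H_def using s
      by (intro order_trans[OF norm_triangle_ineq]) (simp add: abs_mult abs_spow mult_ac)
    also have "norm x powr (- \<gamma>) = norm x powr (- a) * norm x powr (a - \<gamma>)"
      by (simp flip: powr_add)
    also have "norm x powr (- \<gamma> - 2) * norm x = norm x powr (- \<gamma> - 2) * norm x powr 1"
      by simp
    also have "\<dots> = norm x powr (- a - 1) * norm x powr (a - \<gamma>)"
      unfolding powr_add[symmetric] by simp
    also have "\<bar>f x\<bar> powr s = \<bar>f x\<bar> powr 1 * \<bar>f x\<bar> powr (s - 1)"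
      unfolding powr_add[symmetric] by simp
    finally show "norm (H x) \<le> s * (A x * B x) + \<bar>\<gamma>\<bar> * (A' x * B x)"
      by (simp add: A_def A'_def B_def mult_ac)
  qed (use C1c_integrable_grad[OF CH] AB A'B in auto)
  also have "\<dots> = s * (\<integral>x. A x * B x \<partial>lborel) + \<bar>\<gamma>\<bar> * (\<integral>x. A' x * B x \<partial>lborel)"
    using AB A'B by simp
  also have "\<dots> \<le> s * (sqrt (energy a G) * sqrt (ckn_int a (2 * (s - 1)) f))
     + \<bar>\<gamma>\<bar> * ((k * sqrt (energy a G)) * sqrt (ckn_int a (2 * (s - 1)) f))"
    using s AB(2) order_trans[OF A'B(2) mult_right_mono[OF sqrt2]] ckn_int_nonneg
    by (intro add_mono mult_left_mono) auto
  also have "\<dots> = (s + \<bar>\<gamma>\<bar> * k) * (sqrt (energy a G) * sqrt (ckn_int a (2 * (s - 1)) f))"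
    by (simp add: algebra_simps)
  finally show "(\<integral>x. norm (H x) \<partial>lborel) \<le> (s + \<bar>\<gamma>\<bar> * (2 / (real DIM('a) - 2 - 2 * a)))
      * (sqrt (energy a G) * sqrt (ckn_int a (2 * (s - 1)) f))" unfolding k_def .
qed

lemma ckn_step:
  fixes a s :: real
  assumes a: "2 * a + 2 < real DIM('a::euclidean_space)" and s: "2 \<le> s" and d: "2 \<le> DIM('a)"
  defines "r \<equiv> real DIM('a) / (real DIM('a) - 1)"
  obtains K where "0 \<le> K" "\<And>(f :: 'a \<Rightarrow> real) G. C1c f G \<Longrightarrow>
    ckn_int a (s * r) f \<le> (K * (sqrt (energy a G) * sqrt (ckn_int a (2 * (s - 1)) f))) powr r"
proof
  define \<gamma> where "\<gamma> = (a - (real DIM('a) - 2) / 2) * s + real DIM('a) - 1"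
  define K where "K = s + \<bar>\<gamma>\<bar> * (2 / (real DIM('a) - 2 - 2 * a))"
  show "0 \<le> K" using a s by (simp add: K_def)
  fix f :: "'a \<Rightarrow> real" and G assume C: "C1c f G"
  have r: "0 < r" using d by (simp add: r_def)
  obtain H where H: "C1c (\<lambda>x. \<bar>f x\<bar> powr s * norm x powr (- \<gamma>)) H"
    "(\<integral>x. norm (H x) \<partial>lborel) \<le> K * (sqrt (energy a G) * sqrt (ckn_int a (2 * (s - 1)) f))"
    using weighted_power_C1c[OF C a s] unfolding \<gamma>_def K_def by blast
  have "\<gamma> * r = ckn_wt TYPE('a) a (s * r)"
    using d by (simp add: \<gamma>_def ckn_wt_def r_def field_simps)
  then have "ckn_int a (s * r) f = (\<integral>x. \<bar>\<bar>f x\<bar> powr s * norm x powr (- \<gamma>)\<bar> powr r \<partial>lborel)"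
    by (simp add: ckn_int_def powr_mult powr_powr)
  also have "\<dots> \<le> (\<integral>x. norm (H x) \<partial>lborel) powr r"
    using Gagliardo_Nirenberg[OF H(1) d] unfolding r_def .
  also have "\<dots> \<le> (K * (sqrt (energy a G) * sqrt (ckn_int a (2 * (s - 1)) f))) powr r"
    using H(2) r by (intro powr_mono2) (auto intro!: integral_nonneg_AE)
  finally show "ckn_int a (s * r) f \<le> (K * (sqrt (energy a G) * sqrt (ckn_int a (2 * (s - 1)) f))) powr r" .
qed

lemma ckn_C1c_1D:
  assumes a: "2 * a + 2 < real DIM('a::euclidean_space)" and d: "DIM('a) = 1" and p: "2 \<le> p"
  shows "ckn_C1c TYPE('a) a p"
proof -
  define \<gamma> where "\<gamma> = (a - (real DIM('a) - 2) / 2) * 2 + real DIM('a) - 1"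
  define k where "k = 2 / (real DIM('a) - 2 - 2 * a)"
  define K where "K = (2 + \<bar>\<gamma>\<bar> * k) * k"
  have k: "0 \<le> k" using a by (simp add: k_def)
  have K: "0 \<le> K" using k by (simp add: K_def)
  have "ckn_int a p f \<le> (K powr ((p - 2) / 2) * k\<^sup>2) * energy a G powr (p / 2)"
    if C: "C1c f G" for f :: "'a \<Rightarrow> real" and G
  proof -
    obtain H where H: "C1c (\<lambda>x. \<bar>f x\<bar> powr 2 * norm x powr (- \<gamma>)) H"
      "(\<integral>x. norm (H x) \<partial>lborel) \<le> (2 + \<bar>\<gamma>\<bar> * k) * (sqrt (energy a G) * sqrt (ckn_int a 2 f))"
      using weighted_power_C1c[OF C a order_refl] unfolding \<gamma>_def k_def by auto
    have N2: "ckn_int a 2 f \<le> k\<^sup>2 * energy a G"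
      using ckn_int_2_le[OF C a] unfolding k_def .
    have "sqrt (ckn_int a 2 f) \<le> k * sqrt (energy a G)"
      using real_sqrt_le_mono[OF N2] k by (simp add: real_sqrt_mult)
    then have "sqrt (energy a G) * sqrt (ckn_int a 2 f) \<le> sqrt (energy a G) * (k * sqrt (energy a G))"
      using energy_nonneg[of a G] by (intro mult_left_mono) auto
    then have "(2 + \<bar>\<gamma>\<bar> * k) * (sqrt (energy a G) * sqrt (ckn_int a 2 f))
        \<le> (2 + \<bar>\<gamma>\<bar> * k) * (sqrt (energy a G) * (k * sqrt (energy a G)))"
      by (rule mult_left_mono) (use k in simp)
    also have "\<dots> = K * energy a G"
      using energy_nonneg[of a G] by (simp add: K_def)
    finally have "(2 + \<bar>\<gamma>\<bar> * k) * (sqrt (energy a G) * sqrt (ckn_int a 2 f)) \<le> K * energy a G" .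
    then have bound: "\<bar>f x\<bar> powr 2 * norm x powr (- \<gamma>) \<le> K * energy a G" for x
      using C1c_abs_le_integral_1D[OF H(1) d, of x] H(2) by simp
    have wt: "- ckn_wt TYPE('a) a p = - \<gamma> * ((p - 2) / 2) + - ckn_wt TYPE('a) a 2"
      using d by (simp add: ckn_wt_def \<gamma>_def field_simps)
    have "ckn_int a p f \<le> (\<integral>x. (K * energy a G) powr ((p - 2) / 2) * (\<bar>f x\<bar> powr 2 * norm x powr (- ckn_wt TYPE('a) a 2)) \<partial>lborel)"
      unfolding ckn_int_def
    proof (rule integral_mono)
      fix x
      have "\<bar>f x\<bar> powr p = \<bar>f x\<bar> powr (2 * ((p - 2) / 2) + 2)" by (simp add: field_simps)
      also have "\<dots> = (\<bar>f x\<bar> powr 2) powr ((p - 2) / 2) * \<bar>f x\<bar> powr 2"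
        unfolding powr_add powr_powr ..
      finally have "\<bar>f x\<bar> powr p * norm x powr (- ckn_wt TYPE('a) a p)
         = (\<bar>f x\<bar> powr 2 * norm x powr (- \<gamma>)) powr ((p - 2) / 2) * (\<bar>f x\<bar> powr 2 * norm x powr (- ckn_wt TYPE('a) a 2))"
        unfolding wt powr_add by (simp add: powr_mult powr_powr)
      also have "\<dots> \<le> (K * energy a G) powr ((p - 2) / 2) * (\<bar>f x\<bar> powr 2 * norm x powr (- ckn_wt TYPE('a) a 2))"
        using p bound[of x] by (intro mult_right_mono powr_mono2) auto
      finally show "\<bar>f x\<bar> powr p * norm x powr (- ckn_wt TYPE('a) a p)
        \<le> (K * energy a G) powr ((p - 2) / 2) * (\<bar>f x\<bar> powr 2 * norm x powr (- ckn_wt TYPE('a) a 2))" .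
    qed (use p in \<open>auto intro!: integrable_mult_right C1c_integrable_powr[OF C] simp del: powr_numeral\<close>)
    also have "\<dots> = (K * energy a G) powr ((p - 2) / 2) * ckn_int a 2 f"
      by (simp add: ckn_int_def)
    also have "\<dots> \<le> (K * energy a G) powr ((p - 2) / 2) * (k\<^sup>2 * energy a G)"
      using N2 by (intro mult_left_mono) auto
    also have "\<dots> = (K powr ((p - 2) / 2) * k\<^sup>2) * (energy a G powr ((p - 2) / 2) * energy a G powr 1)"
      using K energy_nonneg[of a G] by (simp add: powr_mult)
    also have "energy a G powr ((p - 2) / 2) * energy a G powr 1 = energy a G powr (p / 2)"
      unfolding powr_add[symmetric] by (simp add: field_simps)
    finally show ?thesis .
  qed
  then show ?thesis
    unfolding ckn_C1c_def by (intro exI[of _ "K powr ((p - 2) / 2) * k\<^sup>2"]) auto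
qed

lemma ckn_C1c_2D:
  assumes a: "2 * a + 2 < real DIM('a::euclidean_space)" and d: "DIM('a) = 2"
  shows "ckn_C1c TYPE('a) a (2 * real n + 2)"
proof (induction n)
  case 0
  then show ?case using ckn_C1c_2[OF a] by simp
next
  case (Suc n)
  define p where "p = 2 * real n + 2"
  obtain C where C: "0 \<le> C" "\<And>(f :: 'a \<Rightarrow> real) G. C1c f G \<Longrightarrow> ckn_int a p f \<le> C * energy a G powr (p / 2)"
    using Suc unfolding ckn_C1c_def p_def by auto
  obtain K where K: "0 \<le> K" "\<And>(f :: 'a \<Rightarrow> real) G. C1c f G \<Longrightarrow>
      ckn_int a (2 * real (Suc n) + 2) f \<le> (K * (sqrt (energy a G) * sqrt (ckn_int a p f))) powr 2"
    using ckn_step[OF a, of "real n + 2"] d by (auto simp: p_def algebra_simps)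
  have "ckn_int a (2 * real (Suc n) + 2) f \<le> (K\<^sup>2 * C) * energy a G powr ((2 * real (Suc n) + 2) / 2)"
    if f: "C1c f G" for f :: "'a \<Rightarrow> real" and G
  proof -
    have "ckn_int a (2 * real (Suc n) + 2) f \<le> K\<^sup>2 * (energy a G * ckn_int a p f)"
      using K(2)[OF f] K(1) energy_nonneg[of a G] ckn_int_nonneg[of a p f]
      by (simp add: power_mult_distrib)
    also have "\<dots> \<le> K\<^sup>2 * (energy a G * (C * energy a G powr (p / 2)))"
      using C(2)[OF f] energy_nonneg[of a G] by (intro mult_left_mono) auto
    also have "\<dots> = (K\<^sup>2 * C) * (energy a G powr 1 * energy a G powr (p / 2))"
      using energy_nonneg[of a G] by simp
    also have "energy a G powr 1 * energy a G powr (p / 2) = energy a G powr ((2 * real (Suc n) + 2) / 2)"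
      unfolding powr_add[symmetric] by (simp add: p_def field_simps)
    finally show ?thesis .
  qed
  then show ?case
    unfolding ckn_C1c_def using C by (intro exI[of _ "K\<^sup>2 * C"]) auto
qed

text \<open>The critical exponent is the fixed point of the step, so the integral can be absorbed.\<close>
lemma ckn_C1c_critical:
  assumes a: "2 * a + 2 < real DIM('a::euclidean_space)" and d: "3 \<le> DIM('a)"
  defines "P \<equiv> 2 * real DIM('a) / (real DIM('a) - 2)"
  shows "ckn_C1c TYPE('a) a P"
proof -
  define D where "D = real DIM('a)"
  have D: "3 \<le> D" using d by (simp add: D_def)
  define r where "r = D / (D - 1)"
  define s where "s = 2 * (D - 1) / (D - 2)"
  have s: "2 \<le> s" using D by (simp add: s_def field_simps)
  obtain x where x: "D = x + 2" "0 < x" using D by (intro that[of "D - 2"]) auto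
  have rx: "r = (x + 2) / (x + 1)" and sx: "s = 2 * (x + 1) / x" and Px: "P = 2 * (x + 2) / x"
    unfolding s_def r_def P_def D_def[symmetric] x(1) by simp_all
  have nz: "x * (x + 1) \<noteq> 0" "x \<noteq> 0" using x by auto
  have sr: "s * r = P"
    unfolding rx sx Px times_divide_times_eq frac_eq_eq[OF nz] by (simp add: algebra_simps)
  have ss: "2 * (s - 1) = P"
    using x unfolding sx Px by (simp add: field_simps)
  obtain K where K: "0 \<le> K" "\<And>(f :: 'a \<Rightarrow> real) G. C1c f G \<Longrightarrow>
      ckn_int a P f \<le> (K * (sqrt (energy a G) * sqrt (ckn_int a P f))) powr r"
    using ckn_step[OF a s] d sr ss unfolding r_def D_def by auto
  have "ckn_int a P f \<le> K powr P * energy a G powr (P / 2)"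
    if f: "C1c f G" for f :: "'a \<Rightarrow> real" and G
  proof (cases "ckn_int a P f = 0")
    case True
    then show ?thesis by simp
  next
    case False
    define N where "N = ckn_int a P f"
    define E where "E = energy a G"
    have N: "0 < N" and E: "0 \<le> E"
      using False ckn_int_nonneg[of a P f] energy_nonneg[of a G] by (auto simp: N_def E_def)
    define t where "t = 1 - r / 2"
    have tx: "t = x / (2 * (x + 1))"
      using x by (simp add: t_def rx field_simps)
    have nz': "(x + 1) * x \<noteq> 0" using x by simp
    have t: "0 < t" "r / t = P"
      using x unfolding tx rx Px divide_divide_times_eq frac_eq_eq[OF nz' nz(2)]
      by (simp_all add: algebra_simps)
    have "N \<le> (K * (sqrt E * sqrt N)) powr r"
      using K(2)[OF f] unfolding N_def E_def .
    also have "\<dots> = (K * sqrt E) powr r * N powr (r / 2)"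
      using K N E by (simp add: powr_mult powr_half_sqrt[symmetric] powr_powr mult_ac)
    finally have "N powr t \<le> (K * sqrt E) powr r"
      using N unfolding t_def powr_diff by (simp add: pos_divide_le_eq)
    then have "(N powr t) powr (1 / t) \<le> ((K * sqrt E) powr r) powr (1 / t)"
      using t by (intro powr_mono2) auto
    then have "N \<le> (K * sqrt E) powr P"
      using t N by (simp add: powr_powr)
    also have "\<dots> = K powr P * E powr (P / 2)"
      using K E by (simp add: powr_mult powr_half_sqrt[symmetric] powr_powr)
    finally show ?thesis unfolding N_def E_def .
  qed
  then show ?thesis
    unfolding ckn_C1c_def by (intro exI[of _ "K powr P"]) auto
qed

lemma ckn_C1c_interpolate:
  assumes a: "2 * a + 2 < real DIM('a::euclidean_space)"
    and P: "ckn_C1c TYPE('a) a P" and p: "2 \<le> p" "p \<le> P"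
  shows "ckn_C1c TYPE('a) a p"
proof (cases "p = 2 \<or> p = P")
  case True
  then show ?thesis using P ckn_C1c_2[OF a] by auto
next
  case False
  then have p: "2 < p" "p < P" using p by auto
  define l where "l = (p - 2) / (P - 2)"
  have l: "0 < l" "l < 1" using p by (auto simp: l_def)
  have "(P - 2) * l = p - 2" using p by (simp add: l_def)
  then have pl: "p = P * l + 2 * (1 - l)" by (simp add: algebra_simps)
  obtain C where C: "0 \<le> C" "\<And>(f :: 'a \<Rightarrow> real) G. C1c f G \<Longrightarrow> ckn_int a P f \<le> C * energy a G powr (P / 2)"
    using P unfolding ckn_C1c_def by auto
  obtain C' where C': "0 \<le> C'" "\<And>(f :: 'a \<Rightarrow> real) G. C1c f G \<Longrightarrow> ckn_int a 2 f \<le> C' * energy a G powr (2 / 2)"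
    using ckn_C1c_2[OF a] unfolding ckn_C1c_def by auto
  have wt: "- ckn_wt TYPE('a) a p = - ckn_wt TYPE('a) a P * l + - ckn_wt TYPE('a) a 2 * (1 - l)"
    unfolding ckn_wt_def pl by (simp add: field_simps)
  have "ckn_int a p f \<le> (C powr l * C' powr (1 - l)) * energy a G powr (p / 2)"
    if f: "C1c f G" for f :: "'a \<Rightarrow> real" and G
  proof -
    have "ckn_int a p f = (\<integral>x. (\<bar>f x\<bar> powr P * norm x powr (- ckn_wt TYPE('a) a P)) powr l
        * (\<bar>f x\<bar> powr 2 * norm x powr (- ckn_wt TYPE('a) a 2)) powr (1 - l) \<partial>lborel)"
      unfolding ckn_int_def wt
      by (subst (1) pl, unfold powr_add powr_powr[symmetric])
        (simp add: powr_mult mult_ac)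
    also have "\<dots> \<le> ckn_int a P f powr l * ckn_int a 2 f powr (1 - l)"
      unfolding ckn_int_def using p l
      by (intro Holder_integral_le C1c_integrable_powr[OF f]) auto
    also have "\<dots> \<le> (C * energy a G powr (P / 2)) powr l * (C' * energy a G powr (2 / 2)) powr (1 - l)"
      using C(2)[OF f] C'(2)[OF f] l ckn_int_nonneg
      by (intro mult_mono powr_mono2) auto
    also have "\<dots> = (C powr l * C' powr (1 - l)) * (energy a G powr (P / 2 * l) * energy a G powr (2 / 2 * (1 - l)))"
      using C C' unfolding powr_powr[symmetric] by (simp add: powr_mult)
    also have "energy a G powr (P / 2 * l) * energy a G powr (2 / 2 * (1 - l)) = energy a G powr (p / 2)"
      unfolding powr_add[symmetric] pl by (simp add: field_simps)
    finally show ?thesis .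
  qed
  then show ?thesis
    unfolding ckn_C1c_def by (intro exI[of _ "C powr l * C' powr (1 - l)"]) auto
qed

theorem Caffarelli_Kohn_Nirenberg_C1c:
  assumes adm: "admissible DIM('a::euclidean_space) a b p"
  shows "ckn_C1c TYPE('a) a p"
proof -
  have a: "2 * a + 2 < real DIM('a)" and p: "2 \<le> p"
    and p3: "3 \<le> DIM('a) \<Longrightarrow> p \<le> 2 * real DIM('a) / (real DIM('a) - 2)"
    using adm by (auto simp: admissible_def Let_def)
  consider "DIM('a) = 1" | "DIM('a) = 2" | "3 \<le> DIM('a)"
    using DIM_positive[where 'a='a] by linarith
  then show ?thesis
  proof cases
    case 1
    then show ?thesis by (rule ckn_C1c_1D[OF a _ p])
  next
    case 2
    obtain n where "p \<le> real n" using real_arch_simple by blast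
    then have "p \<le> 2 * real n + 2" by simp
    then show ?thesis by (rule ckn_C1c_interpolate[OF a ckn_C1c_2D[OF a 2] p])
  next
    case 3
    then show ?thesis by (intro ckn_C1c_interpolate[OF a ckn_C1c_critical[OF a 3] p] p3)
  qed
qed

subsection \<open>Weighted Sobolev functions\<close>

definition wL2 :: "real \<Rightarrow> ('a::euclidean_space \<Rightarrow> 'a) \<Rightarrow> bool" where
  "wL2 a G \<longleftrightarrow> G \<in> borel_measurable borel \<and> integrable lborel (\<lambda>x. (norm (G x))\<^sup>2 * norm x powr (- 2 * a))"

lemma norm_diff_sq_le:
  fixes x y :: "'a::real_normed_vector"
  shows "(norm (x - y))\<^sup>2 \<le> 2 * (norm x)\<^sup>2 + 2 * (norm y)\<^sup>2"
proof -
  have "(norm (x - y))\<^sup>2 \<le> (norm x + norm y)\<^sup>2"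
    by (intro power_mono norm_triangle_ineq4) auto
  also have "\<dots> \<le> 2 * (norm x)\<^sup>2 + 2 * (norm y)\<^sup>2"
    using zero_le_power2[of "norm x - norm y"] by (simp add: power2_sum power2_diff)
  finally show ?thesis .
qed

lemma wL2_diff:
  assumes G: "wL2 a G" and H: "wL2 a H"
  shows "wL2 a (\<lambda>x. G x - H x)"
    and "energy a (\<lambda>x. G x - H x) \<le> 2 * energy a G + 2 * energy a H"
proof -
  have [measurable]: "G \<in> borel_measurable borel" "H \<in> borel_measurable borel"
    and i: "integrable lborel (\<lambda>x. (norm (G x))\<^sup>2 * norm x powr (- 2 * a))"
      "integrable lborel (\<lambda>x. (norm (H x))\<^sup>2 * norm x powr (- 2 * a))"
    using assms by (auto simp: wL2_def)
  have i2: "integrable lborel (\<lambda>x. 2 * ((norm (G x))\<^sup>2 * norm x powr (- 2 * a)) + 2 * ((norm (H x))\<^sup>2 * norm x powr (- 2 * a)))"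
    using i by auto
  have le: "(norm (G x - H x))\<^sup>2 * norm x powr (- 2 * a)
      \<le> 2 * ((norm (G x))\<^sup>2 * norm x powr (- 2 * a)) + 2 * ((norm (H x))\<^sup>2 * norm x powr (- 2 * a))" for x
    using mult_right_mono[OF norm_diff_sq_le[of "G x" "H x"], of "norm x powr (- 2 * a)"]
    by (simp add: algebra_simps)
  have i3: "integrable lborel (\<lambda>x. (norm (G x - H x))\<^sup>2 * norm x powr (- 2 * a))"
    by (rule Bochner_Integration.integrable_bound[OF i2]) (use le in \<open>auto intro!: AE_I2\<close>)
  then show "wL2 a (\<lambda>x. G x - H x)" by (simp add: wL2_def)
  have "energy a (\<lambda>x. G x - H x) \<le> (\<integral>x. 2 * ((norm (G x))\<^sup>2 * norm x powr (- 2 * a)) + 2 * ((norm (H x))\<^sup>2 * norm x powr (- 2 * a)) \<partial>lborel)"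
    unfolding energy_def by (rule integral_mono[OF i3 i2 le])
  also have "\<dots> = 2 * energy a G + 2 * energy a H"
    unfolding energy_def using i by simp
  finally show "energy a (\<lambda>x. G x - H x) \<le> 2 * energy a G + 2 * energy a H" .
qed

lemma wL2_inner:
  assumes G: "wL2 a G" and H: "wL2 a H"
  shows wL2_inner_integrable: "integrable lborel (\<lambda>x. (G x \<bullet> H x) * norm x powr (- 2 * a))"
    and wL2_inner_le: "\<bar>\<integral>x. (G x \<bullet> H x) * norm x powr (- 2 * a) \<partial>lborel\<bar> \<le> sqrt (energy a G) * sqrt (energy a H)"
proof -
  have [measurable]: "G \<in> borel_measurable borel" "H \<in> borel_measurable borel"
    and i: "integrable lborel (\<lambda>x. (norm (G x))\<^sup>2 * norm x powr (- 2 * a))"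
      "integrable lborel (\<lambda>x. (norm (H x))\<^sup>2 * norm x powr (- 2 * a))"
    using assms by (auto simp: wL2_def)
  have sq: "(norm (F x) * norm x powr (- a))\<^sup>2 = (norm (F x))\<^sup>2 * norm x powr (- 2 * a)" for F :: "'a \<Rightarrow> 'a" and x
    by (simp add: power_mult_distrib norm_powr_sq)
  have CS: "integrable lborel (\<lambda>x. (norm (G x) * norm x powr (- a)) * (norm (H x) * norm x powr (- a)))"
    "(\<integral>x. (norm (G x) * norm x powr (- a)) * (norm (H x) * norm x powr (- a)) \<partial>lborel)
      \<le> sqrt (energy a G) * sqrt (energy a H)"
    using Cauchy_Schwarz_integral[of "\<lambda>x. norm (G x) * norm x powr (- a)" lborel
        "\<lambda>x. norm (H x) * norm x powr (- a)"] i
    unfolding sq energy_def by auto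
  have le: "norm ((G x \<bullet> H x) * norm x powr (- 2 * a))
      \<le> (norm (G x) * norm x powr (- a)) * (norm (H x) * norm x powr (- a))" for x
  proof -
    have "norm ((G x \<bullet> H x) * norm x powr (- 2 * a)) = \<bar>G x \<bullet> H x\<bar> * norm x powr (- a + - a)"
      by (simp add: abs_mult)
    also have "\<dots> \<le> norm (G x) * norm (H x) * norm x powr (- a + - a)"
      by (intro mult_right_mono Cauchy_Schwarz_ineq2) auto
    finally show ?thesis unfolding powr_add by (simp add: mult_ac)
  qed
  show int: "integrable lborel (\<lambda>x. (G x \<bullet> H x) * norm x powr (- 2 * a))"
    by (rule Bochner_Integration.integrable_bound[OF CS(1)]) (use le in \<open>auto intro!: AE_I2 simp: abs_mult\<close>)
  have "\<bar>\<integral>x. (G x \<bullet> H x) * norm x powr (- 2 * a) \<partial>lborel\<bar>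
      \<le> (\<integral>x. norm ((G x \<bullet> H x) * norm x powr (- 2 * a)) \<partial>lborel)"
    using integral_norm_bound[of lborel "\<lambda>x. (G x \<bullet> H x) * norm x powr (- 2 * a)"]
    unfolding real_norm_def .
  also have "\<dots> \<le> (\<integral>x. (norm (G x) * norm x powr (- a)) * (norm (H x) * norm x powr (- a)) \<partial>lborel)"
    by (rule integral_mono[OF integrable_norm[OF int] CS(1) le])
  finally show "\<bar>\<integral>x. (G x \<bullet> H x) * norm x powr (- 2 * a) \<partial>lborel\<bar> \<le> sqrt (energy a G) * sqrt (energy a H)"
    using CS(2) by linarith
qed

lemma C1c_wL2: "C1c f G \<Longrightarrow> wL2 a G"
  unfolding wL2_def using C1c_measurable C1c_integrable_grad2 by blast

lemma D12_approx:
  fixes u :: "'a::euclidean_space \<Rightarrow> real"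
  assumes "D12 a u g"
  obtains \<phi> where "\<And>k. test_fun (\<phi> k)" "\<And>k. C1c (\<phi> k) (grad (\<phi> k))"
    "AE x in lborel. (\<lambda>k. \<phi> k x) \<longlonglongrightarrow> u x"
    "wL2 a g" "(\<lambda>k. energy a (\<lambda>x. grad (\<phi> k) x - g x)) \<longlonglongrightarrow> 0"
proof -
  obtain \<phi> where t: "\<And>k. test_fun (\<phi> k)" and AE: "AE x in lborel. (\<lambda>k. \<phi> k x) \<longlonglongrightarrow> u x"
    and lim: "(\<lambda>k. \<integral>\<^sup>+x. ennreal ((norm (grad (\<phi> k) x - g x))\<^sup>2 * norm x powr (- 2 * a)) \<partial>lborel) \<longlonglongrightarrow> 0"
    and [measurable]: "g \<in> borel_measurable borel"
    using assms by (auto simp: D12_def)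
  have C: "C1c (\<phi> k) (grad (\<phi> k))" for k
    by (rule test_fun_imp_C1c[OF t])
  have [measurable]: "grad (\<phi> k) \<in> borel_measurable borel" for k
    using C1c_measurable[OF C] by auto
  have "\<forall>\<^sub>F k in sequentially. (\<integral>\<^sup>+x. ennreal ((norm (grad (\<phi> k) x - g x))\<^sup>2 * norm x powr (- 2 * a)) \<partial>lborel) < 1"
    using order_tendstoD(2)[OF lim] by simp
  then obtain k where "(\<integral>\<^sup>+x. ennreal ((norm (grad (\<phi> k) x - g x))\<^sup>2 * norm x powr (- 2 * a)) \<partial>lborel) < 1"
    by (auto simp: eventually_sequentially)
  then have "wL2 a (\<lambda>x. grad (\<phi> k) x - g x)"
    unfolding wL2_def by (auto intro!: integrableI_nonneg elim: less_trans)
  from wL2_diff(1)[OF C1c_wL2[OF C[of k], of a] this] have g: "wL2 a g"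
    by simp
  have eq: "(\<integral>\<^sup>+x. ennreal ((norm (grad (\<phi> k) x - g x))\<^sup>2 * norm x powr (- 2 * a)) \<partial>lborel)
      = ennreal (energy a (\<lambda>x. grad (\<phi> k) x - g x))" for k
    unfolding energy_def using wL2_diff(1)[OF C1c_wL2[OF C[of k], of a] g]
    by (intro nn_integral_eq_integral) (auto simp: wL2_def)
  have "(\<lambda>k. energy a (\<lambda>x. grad (\<phi> k) x - g x)) \<longlonglongrightarrow> 0"
    using lim unfolding eq ennreal_0[symmetric] by (subst (asm) tendsto_ennreal_iff) (auto simp: energy_nonneg)
  with t C AE g show ?thesis by (rule that)
qed

lemma D12_wL2: "D12 a u g \<Longrightarrow> wL2 a g"
  by (erule D12_approx)

lemma ckn_int_limit:
  fixes u :: "'a::euclidean_space \<Rightarrow> real"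
  assumes C: "0 \<le> C" "\<And>(f :: 'a \<Rightarrow> real) G. C1c f G \<Longrightarrow> ckn_int a p f \<le> C * energy a G powr (p / 2)"
    and p: "2 \<le> p" and [measurable]: "u \<in> borel_measurable borel"
    and F: "\<And>j. C1c (F j) (G j)" and AE: "AE x in lborel. (\<lambda>j. F j x) \<longlonglongrightarrow> u x"
    and e: "\<And>j. energy a (G j) \<le> e j" "e \<longlonglongrightarrow> l"
  shows "integrable lborel (\<lambda>x. \<bar>u x\<bar> powr p * norm x powr (- ckn_wt TYPE('a) a p))"
    and "ckn_int a p u \<le> C * l powr (p / 2)"
proof -
  let ?w = "\<lambda>x::'a. norm x powr (- ckn_wt TYPE('a) a p)"
  have [measurable]: "F j \<in> borel_measurable borel" for j
    using C1c_measurable[OF F] by auto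
  have e0: "0 \<le> e j" for j using e(1)[of j] energy_nonneg[of a "G j"] by linarith
  have "(\<lambda>j. C * e j powr (p / 2)) \<longlonglongrightarrow> C * l powr (p / 2)"
    using p e0 by (intro tendsto_intros tendsto_powr' e(2)) auto
  then have lim: "(\<lambda>j. ennreal (C * e j powr (p / 2))) \<longlonglongrightarrow> ennreal (C * l powr (p / 2))"
    by (rule tendsto_ennrealI)
  have "(\<integral>\<^sup>+x. ennreal (\<bar>u x\<bar> powr p * ?w x) \<partial>lborel)
      = (\<integral>\<^sup>+x. liminf (\<lambda>j. ennreal (\<bar>F j x\<bar> powr p * ?w x)) \<partial>lborel)"
  proof (rule nn_integral_cong_AE, use AE in eventually_elim)
    fix x assume "(\<lambda>j. F j x) \<longlonglongrightarrow> u x"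
    then have "(\<lambda>j. ennreal (\<bar>F j x\<bar> powr p * ?w x)) \<longlonglongrightarrow> ennreal (\<bar>u x\<bar> powr p * ?w x)"
      using p by (intro tendsto_ennrealI tendsto_mult tendsto_powr' tendsto_rabs tendsto_const) auto
    then show "ennreal (\<bar>u x\<bar> powr p * ?w x) = liminf (\<lambda>j. ennreal (\<bar>F j x\<bar> powr p * ?w x))"
      by (rule lim_imp_Liminf[OF sequentially_bot, symmetric])
  qed
  also have "\<dots> \<le> liminf (\<lambda>j. \<integral>\<^sup>+x. ennreal (\<bar>F j x\<bar> powr p * ?w x) \<partial>lborel)"
    by (rule nn_integral_liminf) measurable
  also have "\<dots> \<le> liminf (\<lambda>j. ennreal (C * e j powr (p / 2)))"
  proof (intro Liminf_mono always_eventually allI)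
    fix j
    have "(\<integral>\<^sup>+x. ennreal (\<bar>F j x\<bar> powr p * ?w x) \<partial>lborel) = ennreal (ckn_int a p (F j))"
      unfolding ckn_int_def using p
      by (intro nn_integral_eq_integral C1c_integrable_powr[OF F]) auto
    also have "\<dots> \<le> ennreal (C * energy a (G j) powr (p / 2))"
      by (intro ennreal_leI C(2)[OF F])
    also have "\<dots> \<le> ennreal (C * e j powr (p / 2))"
      using p C(1) e(1)[of j] energy_nonneg[of a "G j"]
      by (intro ennreal_leI mult_left_mono powr_mono2) auto
    finally show "(\<integral>\<^sup>+x. ennreal (\<bar>F j x\<bar> powr p * ?w x) \<partial>lborel) \<le> ennreal (C * e j powr (p / 2))" .
  qed
  also have "\<dots> = ennreal (C * l powr (p / 2))"
    by (rule lim_imp_Liminf[OF sequentially_bot lim])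
  finally have le: "(\<integral>\<^sup>+x. ennreal (\<bar>u x\<bar> powr p * ?w x) \<partial>lborel) \<le> ennreal (C * l powr (p / 2))" .
  show int: "integrable lborel (\<lambda>x. \<bar>u x\<bar> powr p * ?w x)"
    by (rule integrableI_nonneg) (use le in \<open>auto intro: le_less_trans\<close>)
  have "ennreal (ckn_int a p u) \<le> ennreal (C * l powr (p / 2))"
    using le unfolding ckn_int_def by (subst (asm) nn_integral_eq_integral[OF int]) auto
  then show "ckn_int a p u \<le> C * l powr (p / 2)"
    using C(1) by (simp add: ennreal_le_iff)
qed

lemma D12_ckn:
  fixes u :: "'a::euclidean_space \<Rightarrow> real"
  assumes C: "0 \<le> C" "\<And>(f :: 'a \<Rightarrow> real) G. C1c f G \<Longrightarrow> ckn_int a p f \<le> C * energy a G powr (p / 2)"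
    and p: "2 \<le> p" and u: "D12 a u g"
  shows D12_ckn_integrable: "integrable lborel (\<lambda>x. \<bar>u x\<bar> powr p * norm x powr (- ckn_wt TYPE('a) a p))"
    and D12_ckn_int_le: "ckn_int a p u \<le> C * (2 * energy a g) powr (p / 2)"
proof -
  obtain \<phi> where "\<And>k. test_fun (\<phi> k)" and
    \<phi>: "\<And>k. C1c (\<phi> k) (grad (\<phi> k))" "AE x in lborel. (\<lambda>k. \<phi> k x) \<longlonglongrightarrow> u x"
    "wL2 a g" "(\<lambda>k. energy a (\<lambda>x. grad (\<phi> k) x - g x)) \<longlonglongrightarrow> 0"
    by (rule D12_approx[OF u], rule that) blast+
  have [measurable]: "u \<in> borel_measurable borel" using u by (auto simp: D12_def)
  have neg: "wL2 a (\<lambda>x. - g x)" "energy a (\<lambda>x. - g x) = energy a g"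
    using \<phi>(3) by (auto simp: wL2_def energy_def)
  have e: "energy a (grad (\<phi> k)) \<le> 2 * energy a (\<lambda>x. grad (\<phi> k) x - g x) + 2 * energy a g" for k
    using wL2_diff(2)[OF wL2_diff(1)[OF C1c_wL2[OF \<phi>(1)[of k]] \<phi>(3)] neg(1)] neg(2) by simp
  have "(\<lambda>k. 2 * energy a (\<lambda>x. grad (\<phi> k) x - g x) + 2 * energy a g) \<longlonglongrightarrow> 2 * 0 + 2 * energy a g"
    by (intro tendsto_intros \<phi>(4))
  then have lim: "(\<lambda>k. 2 * energy a (\<lambda>x. grad (\<phi> k) x - g x) + 2 * energy a g) \<longlonglongrightarrow> 2 * energy a g"
    by simp
  show "integrable lborel (\<lambda>x. \<bar>u x\<bar> powr p * norm x powr (- ckn_wt TYPE('a) a p))"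
    by (rule ckn_int_limit(1)[OF C p _ \<phi>(1,2) e lim]) auto
  show "ckn_int a p u \<le> C * (2 * energy a g) powr (p / 2)"
    by (rule ckn_int_limit(2)[OF C p _ \<phi>(1,2) e lim]) auto
qed

lemma D12_approx_ckn:
  fixes u :: "'a::euclidean_space \<Rightarrow> real"
  assumes C: "0 \<le> C" "\<And>(f :: 'a \<Rightarrow> real) G. C1c f G \<Longrightarrow> ckn_int a p f \<le> C * energy a G powr (p / 2)"
    and p: "2 \<le> p" and u: "D12 a u g"
  obtains \<phi> where "\<And>k. test_fun (\<phi> k)" "\<And>k. wL2 a (grad (\<phi> k))"
    "(\<lambda>k. energy a (\<lambda>x. grad (\<phi> k) x - g x)) \<longlonglongrightarrow> 0"
    "\<And>k. \<phi> k \<in> borel_measurable borel"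
    "\<And>k. integrable lborel (\<lambda>x. \<bar>\<phi> k x - u x\<bar> powr p * norm x powr (- ckn_wt TYPE('a) a p))"
    "(\<lambda>k. ckn_int a p (\<lambda>x. \<phi> k x - u x)) \<longlonglongrightarrow> 0"
proof -
  obtain \<phi> where t: "\<And>k. test_fun (\<phi> k)" and
    \<phi>: "\<And>k. C1c (\<phi> k) (grad (\<phi> k))" "AE x in lborel. (\<lambda>k. \<phi> k x) \<longlonglongrightarrow> u x"
    "wL2 a g" "(\<lambda>k. energy a (\<lambda>x. grad (\<phi> k) x - g x)) \<longlonglongrightarrow> 0"
    by (rule D12_approx[OF u], rule that) blast+
  define \<epsilon> where "\<epsilon> k = energy a (\<lambda>x. grad (\<phi> k) x - g x)" for k
  have [measurable]: "u \<in> borel_measurable borel" using u by (auto simp: D12_def)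
  have m[measurable]: "\<phi> k \<in> borel_measurable borel" for k using C1c_measurable[OF \<phi>(1)] by auto
  have L: "wL2 a (\<lambda>x. grad (\<phi> k) x - g x)" for k
    by (rule wL2_diff(1)[OF C1c_wL2[OF \<phi>(1)] \<phi>(3)])
  have e: "energy a (\<lambda>x. grad (\<phi> k) x - grad (\<phi> j) x) \<le> 2 * \<epsilon> k + 2 * \<epsilon> j" for k j
    using wL2_diff(2)[OF L[of k] L[of j]] by (simp add: \<epsilon>_def)
  have lim: "(\<lambda>j. 2 * \<epsilon> k + 2 * \<epsilon> j) \<longlonglongrightarrow> 2 * \<epsilon> k" for k
    using tendsto_add[OF tendsto_const[of "2 * \<epsilon> k"] tendsto_mult_right_zero[OF \<phi>(4), of 2]]
    by (simp add: \<epsilon>_def)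
  have AE: "AE x in lborel. (\<lambda>j. \<phi> k x - \<phi> j x) \<longlonglongrightarrow> \<phi> k x - u x" for k
    using \<phi>(2) by eventually_elim (intro tendsto_intros)
  note * = ckn_int_limit[OF C p _ C1c_diff[OF \<phi>(1) \<phi>(1)] AE e lim]
  have i: "integrable lborel (\<lambda>x. \<bar>\<phi> k x - u x\<bar> powr p * norm x powr (- ckn_wt TYPE('a) a p))" for k
    by (rule *(1)) auto
  have le: "ckn_int a p (\<lambda>x. \<phi> k x - u x) \<le> C * (2 * \<epsilon> k) powr (p / 2)" for k
    by (rule *(2)) auto
  have "(\<lambda>k. C * (2 * \<epsilon> k) powr (p / 2)) \<longlonglongrightarrow> C * (2 * 0) powr (p / 2)"
    using p \<phi>(4) by (intro tendsto_intros tendsto_powr') (auto simp: \<epsilon>_def energy_nonneg)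
  then have "(\<lambda>k. C * (2 * \<epsilon> k) powr (p / 2)) \<longlonglongrightarrow> 0"
    by simp
  then have "(\<lambda>k. ckn_int a p (\<lambda>x. \<phi> k x - u x)) \<longlonglongrightarrow> 0"
    by (rule Lim_null_comparison[rotated]) (auto intro!: always_eventually simp: abs_of_nonneg[OF ckn_int_nonneg] le)
  with t C1c_wL2[OF \<phi>(1)] \<phi>(4) m i show ?thesis by (rule that)
qed

lemma dual_pairing:
  fixes v z :: "'a::euclidean_space \<Rightarrow> real"
  assumes p: "2 \<le> p" and q: "q = p / (p - 1)"
    and [measurable]: "v \<in> borel_measurable borel" "z \<in> borel_measurable borel"
    and v: "integrable lborel (\<lambda>x. \<bar>v x\<bar> powr q * norm x powr (-(2*a - b)*q))"
    and z: "integrable lborel (\<lambda>x. \<bar>z x\<bar> powr p * norm x powr (-b*p))"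
  shows dual_pairing_integrable: "integrable lborel (\<lambda>x. v x * z x * norm x powr (-2*a))"
    and dual_pairing_le: "\<bar>\<integral>x. v x * z x * norm x powr (-2*a) \<partial>lborel\<bar>
      \<le> wLp (2*a - b) q v powr (1/q) * wLp b p z powr (1/p)"
proof -
  have l: "0 < 1/q" "1/q < 1" "1 - 1/q = 1/p" using p by (auto simp: q field_simps)
  have q0: "q \<noteq> 0" "p \<noteq> 0" using p q by auto
  have eq: "(\<bar>v x\<bar> powr q * norm x powr (-(2*a - b)*q)) powr (1/q) * (\<bar>z x\<bar> powr p * norm x powr (-b*p)) powr (1 - 1/q)
      = norm (v x * z x * norm x powr (-2*a))" for x
  proof -
    have "norm x powr (-(2*a - b)) * norm x powr (-b) = norm x powr (-2*a)"
      unfolding powr_add[symmetric] by simp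
    then show ?thesis
      unfolding l(3) using q0 by (simp add: powr_mult powr_powr abs_mult mult_ac)
  qed
  note H = Holder_integral[OF v z _ _ l(1,2), unfolded eq]
  have i: "integrable lborel (\<lambda>x. norm (v x * z x * norm x powr (-2*a)))"
    by (rule H(1)) auto
  then show "integrable lborel (\<lambda>x. v x * z x * norm x powr (-2*a))"
    by (subst (asm) integrable_norm_iff) auto
  have le: "(\<integral>x. norm (v x * z x * norm x powr (-2*a)) \<partial>lborel)
      \<le> wLp (2*a - b) q v powr (1/q) * wLp b p z powr (1/p)"
    unfolding wLp_def l(3)[symmetric] by (rule H(2)) auto
  show "\<bar>\<integral>x. v x * z x * norm x powr (-2*a) \<partial>lborel\<bar>
      \<le> wLp (2*a - b) q v powr (1/q) * wLp b p z powr (1/p)"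
    using order_trans[OF integral_norm_bound le] by (simp only: real_norm_def)
qed

lemma admissible_exponent:
  assumes "admissible DIM('a::euclidean_space) a b p"
  shows "- ckn_wt TYPE('a) a p = - b * p" "2 \<le> p"
proof -
  show p: "2 \<le> p" using assms by (simp add: admissible_def Let_def)
  have "b = a - (real DIM('a) - 2) / 2 + real DIM('a) / p"
    using assms by (simp add: admissible_def Let_def)
  then show "- ckn_wt TYPE('a) a p = - b * p"
    using p by (simp add: ckn_wt_def field_simps)
qed

lemma weak_form_D12:
  fixes v w z :: "'a::euclidean_space \<Rightarrow> real"
  assumes adm: "admissible DIM('a) a b p" and q: "q = p / (p - 1)"
    and v[measurable]: "v \<in> borel_measurable borel"
      "integrable lborel (\<lambda>x. \<bar>v x\<bar> powr q * norm x powr (-(2*a - b)*q))"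
    and w: "La_weak a w gw v" "wL2 a gw" and z: "D12 a z gz"
  shows "(\<integral>x. v x * z x * norm x powr (-2*a) \<partial>lborel) = (\<integral>x. (gw x \<bullet> gz x) * norm x powr (-2*a) \<partial>lborel)"
proof -
  note wt = admissible_exponent(1)[OF adm] and p = admissible_exponent(2)[OF adm]
  have ckn_eq: "ckn_int a p f = wLp b p f" for f :: "'a \<Rightarrow> real"
    by (simp only: ckn_int_def wLp_def wt)
  obtain C where C: "0 \<le> C" "\<And>(f :: 'a \<Rightarrow> real) G. C1c f G \<Longrightarrow> ckn_int a p f \<le> C * energy a G powr (p / 2)"
    using Caffarelli_Kohn_Nirenberg_C1c[OF adm] unfolding ckn_C1c_def by auto
  have gz: "wL2 a gz" by (rule D12_wL2[OF z])
  have [measurable]: "z \<in> borel_measurable borel" using z by (auto simp: D12_def)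
  have iz: "integrable lborel (\<lambda>x. v x * z x * norm x powr (-2*a))"
    using D12_ckn_integrable[OF C p z] unfolding wt
    by (intro dual_pairing_integrable[OF p q _ _ v(2)]) auto
  obtain \<phi> where t: "\<And>k. test_fun (\<phi> k)" and L: "\<And>k. wL2 a (grad (\<phi> k))"
    and g: "(\<lambda>k. energy a (\<lambda>x. grad (\<phi> k) x - gz x)) \<longlonglongrightarrow> 0"
    and m[measurable]: "\<And>k. \<phi> k \<in> borel_measurable borel"
    and i: "\<And>k. integrable lborel (\<lambda>x. \<bar>\<phi> k x - z x\<bar> powr p * norm x powr (- ckn_wt TYPE('a) a p))"
    and N: "(\<lambda>k. ckn_int a p (\<lambda>x. \<phi> k x - z x)) \<longlonglongrightarrow> 0"
    by (rule D12_approx_ckn[OF C p z], assumption, rule that) blast+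
  define V where "V = wLp (2*a - b) q v powr (1/q)"
  have D: "integrable lborel (\<lambda>x. v x * (\<phi> k x - z x) * norm x powr (-2*a))"
    "\<bar>\<integral>x. v x * (\<phi> k x - z x) * norm x powr (-2*a) \<partial>lborel\<bar> \<le> V * wLp b p (\<lambda>x. \<phi> k x - z x) powr (1/p)" for k
    using dual_pairing[OF p q v(1) _ v(2) i[of k, unfolded wt]] unfolding V_def by auto
  have split1: "(\<integral>x. v x * \<phi> k x * norm x powr (-2*a) \<partial>lborel)
      = (\<integral>x. v x * (\<phi> k x - z x) * norm x powr (-2*a) \<partial>lborel) + (\<integral>x. v x * z x * norm x powr (-2*a) \<partial>lborel)" for k
    by (subst Bochner_Integration.integral_add[symmetric, OF D(1) iz]) (simp add: algebra_simps)
  have "(\<lambda>k. V * wLp b p (\<lambda>x. \<phi> k x - z x) powr (1/p)) \<longlonglongrightarrow> V * 0 powr (1/p)"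
    using N p unfolding ckn_eq[symmetric]
    by (intro tendsto_intros tendsto_powr') (auto simp: ckn_int_nonneg)
  then have "(\<lambda>k. V * wLp b p (\<lambda>x. \<phi> k x - z x) powr (1/p)) \<longlonglongrightarrow> 0"
    by simp
  then have "(\<lambda>k. \<integral>x. v x * (\<phi> k x - z x) * norm x powr (-2*a) \<partial>lborel) \<longlonglongrightarrow> 0"
    by (rule Lim_null_comparison[rotated]) (use D(2) in auto)
  then have lim1: "(\<lambda>k. \<integral>x. v x * \<phi> k x * norm x powr (-2*a) \<partial>lborel)
      \<longlonglongrightarrow> 0 + (\<integral>x. v x * z x * norm x powr (-2*a) \<partial>lborel)"
    unfolding split1 by (intro tendsto_intros)
  note I = wL2_inner[OF w(2) wL2_diff(1)[OF L gz]]
  have split2: "(\<integral>x. (gw x \<bullet> grad (\<phi> k) x) * norm x powr (-2*a) \<partial>lborel)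
      = (\<integral>x. (gw x \<bullet> (grad (\<phi> k) x - gz x)) * norm x powr (-2*a) \<partial>lborel)
        + (\<integral>x. (gw x \<bullet> gz x) * norm x powr (-2*a) \<partial>lborel)" for k
    by (subst Bochner_Integration.integral_add[symmetric, OF I(1) wL2_inner(1)[OF w(2) gz]])
      (simp add: inner_diff_right algebra_simps)
  have "(\<lambda>k. sqrt (energy a gw) * sqrt (energy a (\<lambda>x. grad (\<phi> k) x - gz x))) \<longlonglongrightarrow> sqrt (energy a gw) * sqrt 0"
    by (intro tendsto_intros g)
  then have "(\<lambda>k. sqrt (energy a gw) * sqrt (energy a (\<lambda>x. grad (\<phi> k) x - gz x))) \<longlonglongrightarrow> 0"
    by simp
  then have "(\<lambda>k. \<integral>x. (gw x \<bullet> (grad (\<phi> k) x - gz x)) * norm x powr (-2*a) \<partial>lborel) \<longlonglongrightarrow> 0"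
    by (rule Lim_null_comparison[rotated]) (use I(2) in auto)
  then have "(\<lambda>k. \<integral>x. (gw x \<bullet> grad (\<phi> k) x) * norm x powr (-2*a) \<partial>lborel)
      \<longlonglongrightarrow> 0 + (\<integral>x. (gw x \<bullet> gz x) * norm x powr (-2*a) \<partial>lborel)"
    unfolding split2 by (intro tendsto_intros)
  moreover have "(\<integral>x. v x * \<phi> k x * norm x powr (-2*a) \<partial>lborel) = (\<integral>x. (gw x \<bullet> grad (\<phi> k) x) * norm x powr (-2*a) \<partial>lborel)" for k
    using w(1) t unfolding La_weak_def by blast
  ultimately show ?thesis
    using LIMSEQ_unique[OF lim1] by simp
qed

lemma wLp_nonneg: "0 \<le> wLp b p u"
  unfolding wLp_def by (intro integral_nonneg_AE) auto

lemma CKN_finite: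
  assumes adm: "admissible DIM('a::euclidean_space) a b p"
  obtains C where "0 \<le> C"
    "\<And>(u :: 'a \<Rightarrow> real) g. D12 a u g \<Longrightarrow> wLp b p u powr (2/p) \<le> C * energy a g"
    "\<And>(u :: 'a \<Rightarrow> real) g. D12 a u g \<Longrightarrow> integrable lborel (\<lambda>x. \<bar>u x\<bar> powr p * norm x powr (- b * p))"
proof -
  note wt = admissible_exponent(1)[OF adm] and p = admissible_exponent(2)[OF adm]
  have ckn_eq: "ckn_int a p f = wLp b p f" for f :: "'a \<Rightarrow> real"
    by (simp only: ckn_int_def wLp_def wt)
  obtain C where C: "0 \<le> C" "\<And>(f :: 'a \<Rightarrow> real) G. C1c f G \<Longrightarrow> ckn_int a p f \<le> C * energy a G powr (p / 2)"
    using Caffarelli_Kohn_Nirenberg_C1c[OF adm] unfolding ckn_C1c_def by auto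
  show ?thesis
  proof
    show "0 \<le> C powr (2/p) * 2" by simp
    fix u :: "'a \<Rightarrow> real" and g assume u: "D12 a u g"
    show "integrable lborel (\<lambda>x. \<bar>u x\<bar> powr p * norm x powr (- b * p))"
      using D12_ckn_integrable[OF C p u] unfolding wt by auto
    have "wLp b p u \<le> C * (2 * energy a g) powr (p / 2)"
      using D12_ckn_int_le[OF C p u] unfolding ckn_eq by auto
    then have "wLp b p u powr (2/p) \<le> (C * (2 * energy a g) powr (p / 2)) powr (2/p)"
      using p by (intro powr_mono2 wLp_nonneg) auto
    also have "\<dots> = C powr (2/p) * 2 * energy a g"
      using C p energy_nonneg[of a g] by (simp add: powr_mult powr_powr)
    finally show "wLp b p u powr (2/p) \<le> C powr (2/p) * 2 * energy a g" .
  qed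
qed

lemma CKN_const_bound:
  fixes u :: "'a::euclidean_space \<Rightarrow> real"
  assumes adm: "admissible DIM('a) a b p" and u: "D12 a u g" "\<not> (AE x in lborel. u x = 0)"
  shows CKN_wLp_pos: "0 < wLp b p u" and CKN_const_pos: "0 < CKN_const TYPE('a) a b p"
    and CKN_const_le: "\<And>(w :: 'a \<Rightarrow> real) gw. D12 a w gw \<Longrightarrow>
      wLp b p w powr (2/p) \<le> CKN_const TYPE('a) a b p * energy a gw"
proof -
  define S where "S = {C. \<forall>(u :: 'a \<Rightarrow> real) g. D12 a u g \<longrightarrow> wLp b p u powr (2/p) \<le> C * energy a g}"
  have S: "CKN_const TYPE('a) a b p = Inf S" by (simp add: CKN_const_def S_def)
  obtain C0 where C0: "0 \<le> C0"
    "\<And>(u :: 'a \<Rightarrow> real) g. D12 a u g \<Longrightarrow> wLp b p u powr (2/p) \<le> C0 * energy a g"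
    "\<And>(u :: 'a \<Rightarrow> real) g. D12 a u g \<Longrightarrow> integrable lborel (\<lambda>x. \<bar>u x\<bar> powr p * norm x powr (- b * p))"
    by (rule CKN_finite[OF adm], rule that) blast+
  have C0S: "C0 \<in> S" using C0(2) by (auto simp: S_def)
  have lb: "wLp b p z powr (2/p) / energy a gz \<le> C" if "D12 a z gz" "0 < energy a gz" "C \<in> S"
    for z :: "'a \<Rightarrow> real" and gz C
    using that by (auto simp: S_def pos_divide_le_eq)
  show N: "0 < wLp b p u"
  proof (rule ccontr)
    assume "\<not> 0 < wLp b p u"
    then have "wLp b p u = 0" using wLp_nonneg[of b p u] by linarith
    then have "AE x in lborel. \<bar>u x\<bar> powr p * norm x powr (- b * p) = 0"
      unfolding wLp_def using C0(3)[OF u(1)] by (subst (asm) integral_nonneg_eq_0_iff_AE) auto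
    moreover have "AE x in lborel. x \<noteq> (0::'a)"
      by (rule AE_lborel_singleton)
    ultimately have "AE x in lborel. u x = 0"
      by eventually_elim auto
    then show False using u(2) by blast
  qed
  have E: "0 < energy a g"
  proof (rule ccontr)
    assume "\<not> 0 < energy a g"
    then have "energy a g = 0" using energy_nonneg[of a g] by linarith
    then show False using C0(2)[OF u(1)] N by simp
  qed
  have pos: "0 < wLp b p u powr (2/p) / energy a g" using N E by simp
  have "wLp b p u powr (2/p) / energy a g \<le> Inf S"
    using C0S lb[OF u(1) E] by (intro cInf_greatest) auto
  then show "0 < CKN_const TYPE('a) a b p" using pos S by simp
  fix w :: "'a \<Rightarrow> real" and gw assume w: "D12 a w gw"
  show "wLp b p w powr (2/p) \<le> CKN_const TYPE('a) a b p * energy a gw"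
  proof (cases "energy a gw = 0")
    case True
    then show ?thesis using C0(2)[OF w] by simp
  next
    case False
    then have E: "0 < energy a gw" using energy_nonneg[of a gw] by linarith
    have "wLp b p w powr (2/p) / energy a gw \<le> Inf S"
      using C0S lb[OF w E] by (intro cInf_greatest) auto
    then show ?thesis using E S by (simp add: pos_divide_le_eq)
  qed
qed

theorem mainTheorem9:
  fixes u w :: "'a::euclidean_space \<Rightarrow> real" and g gw :: "'a \<Rightarrow> 'a"
    and a b p q \<kappa> :: real and v :: "'a \<Rightarrow> real"
  assumes adm: "admissible DIM('a) a b p"
    and q_def: "q = p / (p - 1)"
    and u_D: "D12 a u g"
    and u_nonneg: "AE x in lborel. u x \<ge> 0"
    and u_nonzero: "\<not> (AE x in lborel. u x = 0)"
    and kappa_def: "\<kappa> = wLp b p u powr (1/p)"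
    and v_def: "v = (\<lambda>x. \<kappa> powr (2 - p) * norm x powr (2*a - b*p) * u x powr (p - 1))"
    and v_Lq: "v \<in> borel_measurable lborel"
              "integrable lborel (\<lambda>x. \<bar>v x\<bar> powr q * norm x powr (-(2*a - b)*q))"
    and w_D: "D12 a w gw"
    and w_inv: "La_weak a w gw v"
  shows "0 \<le> wLp (2*a - b) q v powr (2/q)
              - (1 / CKN_const TYPE('a) a b p) * (\<integral>x. v x * w x * norm x powr (-2*a) \<partial>lborel)
       \<and> wLp (2*a - b) q v powr (2/q)
              - (1 / CKN_const TYPE('a) a b p) * (\<integral>x. v x * w x * norm x powr (-2*a) \<partial>lborel)
         \<le> CKN_const TYPE('a) a b p * energy a g - wLp b p u powr (2/p)"
proof -
  note p = admissible_exponent(2)[OF adm]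
  define C where "C = CKN_const TYPE('a) a b p"
  define N where "N = wLp b p u"
  define M where "M = N powr (2/p)"
  note K = CKN_const_bound[OF adm u_D u_nonzero, folded C_def]
  have N: "0 < N" and C: "0 < C" using K(1,2) by (auto simp: N_def)
  have M: "0 < M" using N by (simp add: M_def)
  have v: "v \<in> borel_measurable borel" using v_Lq(1) by simp
  have [measurable]: "u \<in> borel_measurable borel" "w \<in> borel_measurable borel"
    using u_D w_D by (auto simp: D12_def)
  have \<kappa>: "\<kappa> powr r = N powr (r / p)" for r
    by (simp add: kappa_def N_def powr_powr)
  have q: "q > 1" using p by (simp add: q_def)
  have pq: "(p - 1) * q = p" using p by (simp add: q_def)

  have "wLp (2*a - b) q v = (\<integral>x. N powr ((2 - p) * q / p) * (\<bar>u x\<bar> powr p * norm x powr (- b * p)) \<partial>lborel)"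
    unfolding wLp_def
  proof (rule integral_cong_AE)
    show "AE x in lborel. \<bar>v x\<bar> powr q * norm x powr (-(2*a - b)*q)
        = N powr ((2 - p) * q / p) * (\<bar>u x\<bar> powr p * norm x powr (- b * p))"
      using u_nonneg
    proof eventually_elim
      fix x assume "0 \<le> u x"
      have "\<bar>v x\<bar> powr q = (\<kappa> powr (2 - p)) powr q * (norm x powr (2*a - b*p)) powr q * (u x powr (p - 1)) powr q"
        by (simp add: v_def powr_mult abs_mult)
      also have "\<dots> = N powr ((2 - p) * q / p) * norm x powr ((2*a - b*p) * q) * \<bar>u x\<bar> powr p"
        using \<open>0 \<le> u x\<close> by (simp add: powr_powr pq \<kappa>)
      finally have "\<bar>v x\<bar> powr q * norm x powr (-(2*a - b)*q)
        = N powr ((2 - p) * q / p) * \<bar>u x\<bar> powr p * (norm x powr ((2*a - b*p) * q) * norm x powr (-(2*a - b)*q))"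
        by (simp add: mult_ac)
      also have "norm x powr ((2*a - b*p) * q) * norm x powr (-(2*a - b)*q) = norm x powr (- b * ((p - 1) * q))"
        unfolding powr_add[symmetric] by (rule arg_cong[where f = "(powr) (norm x)"]) (simp add: algebra_simps)
      finally show "\<bar>v x\<bar> powr q * norm x powr (-(2*a - b)*q)
        = N powr ((2 - p) * q / p) * (\<bar>u x\<bar> powr p * norm x powr (- b * p))"
        unfolding pq by (simp add: mult_ac)
    qed
  qed (use v in measurable)
  also have "\<dots> = N powr ((2 - p) * q / p + 1)"
    using N by (simp add: N_def wLp_def powr_add)
  finally have V: "wLp (2*a - b) q v powr r = N powr (((2 - p) * q / p + 1) * r)" for r
    by (simp add: powr_powr)
  have exp: "((2 - p) * q / p + 1) * (1 / q) = 1 / p"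
    using p unfolding q_def by (simp add: field_simps)
  have V1: "wLp (2*a - b) q v powr (1/q) = N powr (1 / p)"
    unfolding V exp ..
  have V2: "wLp (2*a - b) q v powr (2/q) = M"
  proof -
    have "((2 - p) * q / p + 1) * (2 / q) = 2 * (((2 - p) * q / p + 1) * (1 / q))" by simp
    then show ?thesis unfolding V exp M_def by simp
  qed

  have gw: "wL2 a gw" and g: "wL2 a g"
    using D12_wL2 w_D u_D by auto
  have Ew: "(\<integral>x. v x * w x * norm x powr (-2*a) \<partial>lborel) = energy a gw"
    using weak_form_D12[OF adm q_def v v_Lq(2) w_inv gw w_D]
    by (simp add: energy_def power2_norm_eq_inner)
  have "(\<integral>x. v x * u x * norm x powr (-2*a) \<partial>lborel)
      = (\<integral>x. N powr ((2 - p) / p) * (\<bar>u x\<bar> powr p * norm x powr (- b * p)) \<partial>lborel)"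
  proof (rule integral_cong_AE)
    show "AE x in lborel. v x * u x * norm x powr (-2*a) = N powr ((2 - p) / p) * (\<bar>u x\<bar> powr p * norm x powr (- b * p))"
      using u_nonneg
    proof eventually_elim
      fix x assume "0 \<le> u x"
      then have "u x powr (p - 1) * u x = \<bar>u x\<bar> powr (p - 1) * \<bar>u x\<bar> powr 1" by simp
      also have "\<dots> = \<bar>u x\<bar> powr p" unfolding powr_add[symmetric] by simp
      finally have 1: "u x powr (p - 1) * u x = \<bar>u x\<bar> powr p" .
      have 2: "norm x powr (2*a - b*p) * norm x powr (-2*a) = norm x powr (- b * p)"
        unfolding powr_add[symmetric] by simp
      have "v x * u x * norm x powr (-2*a)
          = \<kappa> powr (2 - p) * (u x powr (p - 1) * u x) * (norm x powr (2*a - b*p) * norm x powr (-2*a))"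
        by (simp add: v_def)
      then show "v x * u x * norm x powr (-2*a) = N powr ((2 - p) / p) * (\<bar>u x\<bar> powr p * norm x powr (- b * p))"
        unfolding 1 2 \<kappa> by simp
    qed
  qed (use v in measurable)
  also have "\<dots> = N powr ((2 - p) / p + 1)"
    using N by (simp add: N_def wLp_def powr_add)
  also have "(2 - p) / p + 1 = 2 / p" using p by (simp add: field_simps)
  finally have "M = (\<integral>x. (gw x \<bullet> g x) * norm x powr (-2*a) \<partial>lborel)"
    using weak_form_D12[OF adm q_def v v_Lq(2) w_inv gw u_D] by (simp add: M_def)
  then have MCS: "M \<le> sqrt (energy a gw) * sqrt (energy a g)"
    using wL2_inner_le[OF gw g] by linarith

  have iw: "integrable lborel (\<lambda>x. \<bar>w x\<bar> powr p * norm x powr (- b * p))"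
    by (rule CKN_finite[OF adm]) (use w_D in blast)
  have sqrtM: "N powr (1/p) = sqrt M" "wLp b p w powr (1/p) = sqrt (wLp b p w powr (2/p))"
    by (simp_all add: M_def powr_half_sqrt[symmetric] powr_powr)
  have "energy a gw \<le> sqrt M * sqrt (wLp b p w powr (2/p))"
    using dual_pairing_le[OF p q_def v _ v_Lq(2) iw] energy_nonneg[of a gw]
    unfolding Ew V1 sqrtM by simp
  also have "\<dots> \<le> sqrt M * sqrt (C * energy a gw)"
    using K(3)[OF w_D] M by (intro mult_left_mono) auto
  finally have le: "sqrt (energy a gw) * sqrt (energy a gw) \<le> sqrt (M * C) * sqrt (energy a gw)"
    using energy_nonneg[of a gw] by (simp add: real_sqrt_mult)
  have "energy a gw \<le> M * C"
  proof (cases "energy a gw = 0")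
    case False
    then have "0 < sqrt (energy a gw)" using energy_nonneg[of a gw] by simp
    then have "sqrt (energy a gw) \<le> sqrt (M * C)" by (rule mult_right_le_imp_le[OF le])
    then show ?thesis by simp
  qed (use M C in simp)
  then have first: "0 \<le> M - 1 / C * energy a gw"
    using C by (simp add: field_simps)
  have "0 \<le> (sqrt C * sqrt (energy a g) - sqrt (energy a gw) / sqrt C)\<^sup>2" by simp
  also have "\<dots> = C * energy a g - 2 * (sqrt (energy a gw) * sqrt (energy a g)) + energy a gw / C"
    using C energy_nonneg[of a g] energy_nonneg[of a gw]
    by (simp add: power2_diff power_mult_distrib power_divide)
  finally have "M - 1 / C * energy a gw \<le> C * energy a g - M"
    using MCS by simp
  with first show ?thesis
    unfolding V2 Ew C_def[symmetric] N_def[symmetric] M_def[symmetric] by blast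
qed

end
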